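(* There exist absolute constants $C_0, C_1 > 0$ such that the following holds. Let $m,k,t$ be positive integers with $t \le m$ and $t \geq C_0 \log^2(ek/m)$, let $x^{(0)} \in [-1,1]^k$, and let $A$ be a random $m \times k$ matrix whose columns are independent, each uniformly distributed among the vectors in $\{0,1\}^m$ with exactly $t$ ones. Then with probability at least $1 - \exp(-t)$, there exists $\chi \in \{-1,+1\}^k$ such that for every row $v_j$ of $A$, $|\langle v_j, \chi - x^{(0)} \rangle| \le C_1 \sqrt{t}$. *)

theory Defs
  imports "HOL-Probability.Product_PMF" "Jordan_Normal_Form.Matrix"
begin

(* vectors and matrices are those of Jordan_Normal_Form, so that the dimensions
   can be quantified inside the formula *)
unbundle no vec_syntax
unbundle no inner_syntax

definition sparse_vecs :: "nat \<Rightarrow> nat \<Rightarrow> real vec set" where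
  "sparse_vecs m t =
    {v \<in> carrier_vec m. (\<forall>i<m. v $ i \<in> {0, 1}) \<and> card {i. i < m \<and> v $ i = 1} = t}"

(* P is the law of the random matrix; since it has finite support, there is no loss
   of generality in taking it to be a probability mass function. *)
definition random_sparse_matrix :: "nat \<Rightarrow> nat \<Rightarrow> nat \<Rightarrow> real mat pmf \<Rightarrow> bool" where
  "random_sparse_matrix m k t P \<longleftrightarrow>
    set_pmf P \<subseteq> carrier_mat m k \<and>
    prob_space.indep_vars (measure_pmf P) (\<lambda>_. count_space UNIV) (\<lambda>j A. col A j) {..<k} \<and>
    (\<forall>j<k. map_pmf (\<lambda>A. col A j) P = pmf_of_set (sparse_vecs m t))"

(* The uniform distribution above is only meaningful on a finite nonempty set. *)
lemma finite_sparse_vecs: "finite (sparse_vecs m t)"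
proof (rule finite_subset)
  show "sparse_vecs m t \<subseteq> (\<lambda>S. vec m (indicator S)) ` Pow {..<m}"
  proof
    fix v assume v: "v \<in> sparse_vecs m t"
    have "v = vec m (indicator {i. i < m \<and> v $ i = 1})"
      using v by (intro eq_vecI) (auto simp: sparse_vecs_def indicator_def)
    then show "v \<in> (\<lambda>S. vec m (indicator S)) ` Pow {..<m}"
      by (rule image_eqI) auto
  qed
qed simp

lemma sparse_vecs_nonempty: "t \<le> m \<Longrightarrow> sparse_vecs m t \<noteq> {}"
proof -
  assume t: "t \<le> m"
  then have "{i. i < m \<and> vec m (indicator {..<t}) $ i = (1::real)} = {..<t}"
    by (auto simp: indicator_def split: if_splits)
  then have "vec m (indicator {..<t}) \<in> sparse_vecs m t"
    by (auto simp: sparse_vecs_def indicator_def)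
  then show ?thesis by blast
qed

lemma random_sparse_matrix_exists:
  assumes "t \<le> m"
  shows "\<exists>P. random_sparse_matrix m k t P"
proof -
  define U where "U = pmf_of_set (sparse_vecs m t)"
  define Q where "Q = Pi_pmf {..<k} (0\<^sub>v m) (\<lambda>_. U)"
  define g where "g = (\<lambda>c. mat m k (\<lambda>(i, j). (c j :: real vec) $ i))"
  define P where "P = map_pmf g Q"
  have set_U: "set_pmf U = sparse_vecs m t"
    unfolding U_def using assms by (intro set_pmf_of_set sparse_vecs_nonempty finite_sparse_vecs)
  have Qc: "c j \<in> carrier_vec m" if "c \<in> set_pmf Q" "j < k" for c j
    using that set_U by (auto simp: Q_def set_Pi_pmf PiE_dflt_def sparse_vecs_def)
  have colg: "col (g c) j = c j" if "c \<in> set_pmf Q" "j < k" for c j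
    using Qc[OF that] that by (intro eq_vecI) (auto simp: g_def)
  have comp: "map_pmf (\<lambda>A. col A j) P = map_pmf (\<lambda>c. c j) Q" if "j < k" for j
    unfolding P_def pmf.map_comp using colg that by (intro pmf.map_cong) (auto simp: o_def)
  have "map_pmf (\<lambda>A. col A j) P = U" if "j < k" for j
    unfolding comp[OF that] using that by (simp add: Q_def Pi_pmf_component)
  moreover have "set_pmf P \<subseteq> carrier_mat m k"
    by (auto simp: P_def g_def)
  moreover have "prob_space.indep_vars (measure_pmf P) (\<lambda>_. count_space UNIV)
      (\<lambda>j A. col A j) {..<k}"
  proof (cases "k = 0")
    case True
    then show ?thesis
      by (simp add: prob_space.indep_vars_def [OF measure_pmf.prob_space_axioms]
          prob_space.indep_sets_def [OF measure_pmf.prob_space_axioms])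
  next
    case False
    let ?C = "\<lambda>_. count_space (UNIV :: real vec set)"
    have "distr (measure_pmf P) (PiM {..<k} ?C) (\<lambda>A. \<lambda>j\<in>{..<k}. col A j)
        = distr (measure_pmf Q) (PiM {..<k} ?C) (\<lambda>c. \<lambda>j\<in>{..<k}. col (g c) j)"
      unfolding P_def map_pmf_rep_eq by (subst distr_distr) (auto simp: o_def space_PiM)
    also have "\<dots> = distr (measure_pmf Q) (PiM {..<k} ?C) (\<lambda>c. \<lambda>j\<in>{..<k}. c j)"
      by (intro distr_cong_AE) (auto simp: AE_measure_pmf_iff colg space_PiM intro!: restrict_ext)
    also have "\<dots> = PiM {..<k} (\<lambda>j. distr (measure_pmf Q) (count_space UNIV) (\<lambda>c. c j))"
    proof -
      have "prob_space.indep_vars (measure_pmf Q) ?C (\<lambda>j c. c j) {..<k}"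
        unfolding Q_def by (rule indep_vars_Pi_pmf) simp
      then show ?thesis
        using False
        by (subst (asm) prob_space.indep_vars_iff_distr_eq_PiM' [OF measure_pmf.prob_space_axioms])
          auto
    qed
    also have "\<dots> = PiM {..<k} (\<lambda>j. distr (measure_pmf P) (count_space UNIV) (\<lambda>A. col A j))"
      using comp by (intro PiM_cong) (auto simp flip: map_pmf_rep_eq)
    finally show ?thesis
      using False by (subst prob_space.indep_vars_iff_distr_eq_PiM' [OF measure_pmf.prob_space_axioms]) auto
  qed
  ultimately show ?thesis
    unfolding random_sparse_matrix_def U_def by blast
qed

end

theory Submission
  imports Defs
begin

text \<open>
Call a column set S of size s \<open>\<le>\<close> m \<^emph>\<open>good\<close> if fewer than s/100 rows have at least
9st/m + 500 sqrt t ones in S. A union bound over S, over about s/100 heavy rows and over the positions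
of their ones shows that all S are good with probability at least 1 - exp(-t); the condition on t pays
for the choice of S among k columns. For such a matrix, first move x0 to a point with at
most m fractional coordinates without changing any row sum. Then repeatedly halve the number s of
fractional coordinates: heavy rows are kept fixed, and the light ones move by
O(sqrt t (s/m)^(1/8)), a geometric series. Once st \<open>\<le>\<close> m, the heavy rows are those with more
than O(sqrt t) remaining ones, and the Beck-Fiala argument finishes.
\<close>

section \<open>Linear algebra and compactness\<close>

text \<open>The set of fractional coordinates at each stage depends on the matrix, so goodness has
  to hold for all column sets at once; the rounding itself is then deterministic. Choosing
  \<open>s\<close> of \<open>k\<close> columns costs about exp(s (log(ek/m) + log(m/s))), and the
  hypothesis turns the first logarithm into \<open>sqrt t\<close>. About s/100 heavy rows, each with
  an excess of 500 \<open>sqrt t\<close>, pay for this, which is why \<open>sqrt t\<close> is the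
  natural amount to add to a multiple of the mean row sum st/m. A heavy row has at most s ones, so
  heavy rows force s to be at least 500 \<open>sqrt t\<close>; the total excess is then large
  compared with \<open>t\<close>, whence the failure probability exp(-t).

  A partial coloring with row size r costs the square root of r log(m/s), not of r log m, because a
  small fraction of s rows may be frozen once they reach the allowed deviation. While st is at least
  m, r is at most a constant times t (s/m)^(1/2). Half of the resulting decay (s/m)^(1/4) is spent
  on the square root of the logarithm, and this leaves the exponent 1/8.\<close>

lemma cube_norm_maximizer:
  fixes S :: "'i set" and x0 :: "'i \<Rightarrow> real"
  assumes "closed Q" "x0 \<in> Q" "\<And>i. i \<in> S \<Longrightarrow> \<bar>x0 i\<bar> \<le> 1"
  obtains x where "x \<in> Q" "\<And>i. i \<in> S \<Longrightarrow> \<bar>x i\<bar> \<le> 1" "\<And>i. i \<notin> S \<Longrightarrow> x i = x0 i"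
    "\<And>y. y \<in> Q \<Longrightarrow> (\<And>i. i \<in> S \<Longrightarrow> \<bar>y i\<bar> \<le> 1) \<Longrightarrow> (\<And>i. i \<notin> S \<Longrightarrow> y i = x0 i) \<Longrightarrow>
      (\<Sum>i\<in>S. (y i)\<^sup>2) \<le> (\<Sum>i\<in>S. (x i)\<^sup>2)"
proof -
  \<comment> \<open>The factors outside \<open>S\<close> are single points, so this product over the
    whole, possibly infinite, index type is compact by Tychonoff and no restriction to
    \<open>S\<close> is needed.\<close>
  define K where "K = PiE UNIV (\<lambda>i. if i \<in> S then {-1..1} else {x0 i}) \<inter> Q"
  have "compactin (product_topology (\<lambda>_. euclidean) UNIV) (PiE UNIV (\<lambda>i. if i \<in> S then {-1..1} else {x0 i}))"
    by (subst compactin_PiE) (auto simp: compactin_euclidean_iff)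
  then have "compact (PiE UNIV (\<lambda>i. if i \<in> S then {-1..1} else {x0 i}))"
    by (simp add: euclidean_product_topology compactin_euclidean_iff)
  then have "compact K"
    unfolding K_def using assms(1) by (rule compact_Int_closed)
  have K_iff: "y \<in> K \<longleftrightarrow> y \<in> Q \<and> (\<forall>i\<in>S. \<bar>y i\<bar> \<le> 1) \<and> (\<forall>i. i \<notin> S \<longrightarrow> y i = x0 i)" for y
    by (auto simp: K_def PiE_iff abs_le_iff split: if_splits)
  have "x0 \<in> K"
    using assms K_iff by auto
  moreover have "continuous_on K (\<lambda>y. \<Sum>i\<in>S. (y i)\<^sup>2)"
    by (intro continuous_intros continuous_on_subset[OF continuous_on_product_coordinates]) auto
  ultimately obtain x where "x \<in> K" "\<And>y. y \<in> K \<Longrightarrow> (\<Sum>i\<in>S. (y i)\<^sup>2) \<le> (\<Sum>i\<in>S. (x i)\<^sup>2)"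
    using continuous_attains_sup[OF \<open>compact K\<close>] by blast
  then show thesis
    using K_iff by (intro that[of x]) auto
qed

text \<open>Gaussian elimination, one equation per induction step: the equation \<open>j0\<close> is
  solved for a pivot coordinate \<open>p\<close> and substituted into the others, which leaves one
  equation and one coordinate fewer.\<close>

lemma homogeneous_solution:
  fixes c :: "'c \<Rightarrow> 'i \<Rightarrow> real"
  assumes "finite C" "finite S" "card C < card S"
  shows "\<exists>b. (\<exists>i\<in>S. b i \<noteq> 0) \<and> (\<forall>i. i \<notin> S \<longrightarrow> b i = 0) \<and> (\<forall>j\<in>C. (\<Sum>i\<in>S. c j i * b i) = 0)"
  using assms
proof (induction C arbitrary: S c rule: finite_induct)
  case empty
  then have "S \<noteq> {}" by auto
  then show ?case
    by (intro exI[of _ "\<lambda>i. if i \<in> S then 1 else 0"]) auto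
next
  case (insert j0 C)
  show ?case
  proof (cases "\<exists>p\<in>S. c j0 p \<noteq> 0")
    case False
    obtain b where "\<exists>i\<in>S. b i \<noteq> 0" "\<forall>i. i \<notin> S \<longrightarrow> b i = 0" "\<forall>j\<in>C. (\<Sum>i\<in>S. c j i * b i) = 0"
      using insert.IH[of S c] insert.prems insert.hyps by auto
    then show ?thesis
      using False by (intro exI[of _ b]) auto
  next
    case True
    then obtain p where p: "p \<in> S" "c j0 p \<noteq> 0" by blast
    define T where "T = S - {p}"
    define c' where "c' = (\<lambda>j i. c j i - c j p * c j0 i / c j0 p)"
    have T: "finite T" "p \<notin> T" "S = insert p T"
      using insert.prems p by (auto simp: T_def)
    then have "card C < card T"
      using insert.prems insert.hyps by simp
    from insert.IH[OF T(1) this, of c'] obtain b where b: "\<exists>i\<in>T. b i \<noteq> 0" "\<And>i. i \<notin> T \<Longrightarrow> b i = 0"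
      "\<And>j. j \<in> C \<Longrightarrow> (\<Sum>i\<in>T. c' j i * b i) = 0" by blast
    define q where "q = - (\<Sum>i\<in>T. c j0 i * b i) / c j0 p"
    have sum_eq: "(\<Sum>i\<in>S. c j i * (b(p := q)) i) = c j p * q + (\<Sum>i\<in>T. c j i * b i)" for j
      using T by (auto intro!: sum.cong)
    have "(\<Sum>i\<in>T. c' j i * b i) = (\<Sum>i\<in>T. c j i * b i) + c j p * q" for j
      by (simp add: c'_def q_def algebra_simps sum_subtractf sum_distrib_left sum_distrib_right)
         (simp add: divide_inverse sum_distrib_left sum_distrib_right mult_ac)
    then have "\<forall>j\<in>C. (\<Sum>i\<in>S. c j i * (b(p := q)) i) = 0"
      using b(3) sum_eq by (metis add.commute)
    moreover have "(\<Sum>i\<in>S. c j0 i * (b(p := q)) i) = 0"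
      using p by (simp only: sum_eq) (simp add: q_def)
    moreover obtain i where i: "i \<in> T" "b i \<noteq> 0"
      using b(1) by blast
    moreover have "i \<in> S" "(b(p := q)) i \<noteq> 0"
      using i T by auto
    moreover have "(b(p := q)) i = 0" if "i \<notin> S" for i
      using that b(2) T by auto
    ultimately show ?thesis
      by blast
  qed
qed

text \<open>The members already found are treated as further linear constraints, so the next one is
  a solution of a homogeneous system that only has to be normalised; the dimension count leaves room
  for \<open>d\<close> rounds.\<close>

lemma orthonormal_family:
  fixes C :: "('i \<Rightarrow> real) set"
  assumes "finite C" "finite S" "card C + d \<le> card S"
  shows "\<exists>b :: nat \<Rightarrow> 'i \<Rightarrow> real.
    (\<forall>n<d. (\<forall>i. i \<notin> S \<longrightarrow> b n i = 0) \<and> (\<forall>v\<in>C. (\<Sum>i\<in>S. v i * b n i) = 0)) \<and>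
    (\<forall>n<d. \<forall>n'<d. (\<Sum>i\<in>S. b n i * b n' i) = (if n = n' then 1 else 0))"
  using assms(3)
proof (induction d)
  case 0
  then show ?case by simp
next
  case (Suc d)
  then have "card C + d \<le> card S" by simp
  from Suc.IH[OF this] obtain b :: "nat \<Rightarrow> 'i \<Rightarrow> real" where
    "\<forall>n<d. (\<forall>i. i \<notin> S \<longrightarrow> b n i = 0) \<and> (\<forall>v\<in>C. (\<Sum>i\<in>S. v i * b n i) = 0)"
    "\<forall>n<d. \<forall>n'<d. (\<Sum>i\<in>S. b n i * b n' i) = (if n = n' then 1 else 0)" by (elim exE conjE)
  then have b: "n < d \<Longrightarrow> i \<notin> S \<Longrightarrow> b n i = 0" "n < d \<Longrightarrow> v \<in> C \<Longrightarrow> (\<Sum>i\<in>S. v i * b n i) = 0"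
    "n < d \<Longrightarrow> n' < d \<Longrightarrow> (\<Sum>i\<in>S. b n i * b n' i) = (if n = n' then 1 else 0)"
    for n n' i v by blast+
  have "card (C \<union> b ` {..<d}) \<le> card C + card (b ` {..<d})"
    by (rule card_Un_le)
  also have "\<dots> \<le> card C + d"
    using card_image_le[of "{..<d}" b] by simp
  finally have "card (C \<union> b ` {..<d}) < card S"
    using Suc.prems by simp
  then obtain v where v: "\<exists>i\<in>S. v i \<noteq> 0" "\<And>i. i \<notin> S \<Longrightarrow> v i = 0"
    "\<And>w. w \<in> C \<union> b ` {..<d} \<Longrightarrow> (\<Sum>i\<in>S. w i * v i) = 0"
    using homogeneous_solution[of "C \<union> b ` {..<d}" S "\<lambda>w. w"] assms by auto
  define N where "N = (\<Sum>i\<in>S. (v i)\<^sup>2)"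
  have N: "N > 0"
    unfolding N_def using v(1) assms(2) by (metis sum_pos2 zero_le_power2 zero_less_power2)
  define v' where "v' = (\<lambda>i. v i / sqrt N)"
  have orth: "(\<Sum>i\<in>S. w i * v' i) = 0" if "w \<in> C \<union> b ` {..<d}" for w
    using v(3)[OF that] by (simp add: v'_def flip: sum_divide_distrib)
  have "(\<Sum>i\<in>S. v' i * v' i) = (\<Sum>i\<in>S. (v i)\<^sup>2 / N)"
    using N by (intro sum.cong) (auto simp: v'_def power2_eq_square)
  also have "\<dots> = 1"
    using N by (simp add: N_def flip: sum_divide_distrib)
  finally have unit: "(\<Sum>i\<in>S. v' i * v' i) = 1" .
  have orth': "(\<Sum>i\<in>S. v' i * w i) = 0" if "w \<in> C \<union> b ` {..<d}" for w
    using orth[OF that] by (simp add: mult.commute)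
  show ?case
    using b v(2) orth orth' unit
    by (intro exI[of _ "b(d := v')"]) (auto simp: less_Suc_eq v'_def)
qed

text \<open>Expands the squared distance from \<open>a\<close> to its projection. What matters for
  the coloring is that the bound has no factor \<open>d\<close>: an average direction disturbs a row
  only by a share 1/d of its squared norm.\<close>

lemma bessel_inequality:
  fixes a :: "'i \<Rightarrow> real" and b :: "nat \<Rightarrow> 'i \<Rightarrow> real"
  assumes "\<And>n n'. n < d \<Longrightarrow> n' < d \<Longrightarrow> (\<Sum>i\<in>S. b n i * b n' i) = (if n = n' then 1 else 0)"
  shows "(\<Sum>n<d. (\<Sum>i\<in>S. a i * b n i)\<^sup>2) \<le> (\<Sum>i\<in>S. (a i)\<^sup>2)"
proof -
  define g where "g = (\<lambda>n. \<Sum>i\<in>S. a i * b n i)"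
  have cross: "(\<Sum>i\<in>S. a i * (\<Sum>n<d. g n * b n i)) = (\<Sum>n<d. (g n)\<^sup>2)"
  proof -
    have "(\<Sum>i\<in>S. a i * (\<Sum>n<d. g n * b n i)) = (\<Sum>n<d. \<Sum>i\<in>S. a i * (g n * b n i))"
      by (subst sum.swap) (simp add: sum_distrib_left)
    also have "\<dots> = (\<Sum>n<d. g n * g n)"
      by (intro sum.cong) (auto simp: g_def sum_distrib_left mult_ac)
    finally show ?thesis by (simp add: power2_eq_square)
  qed
  have square: "(\<Sum>i\<in>S. (\<Sum>n<d. g n * b n i)\<^sup>2) = (\<Sum>n<d. (g n)\<^sup>2)"
  proof -
    have "(\<Sum>i\<in>S. (\<Sum>n<d. g n * b n i)\<^sup>2) = (\<Sum>i\<in>S. \<Sum>n<d. \<Sum>n'<d. g n * g n' * (b n i * b n' i))"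
      by (simp add: power2_eq_square sum_product mult_ac)
    also have "\<dots> = (\<Sum>n<d. \<Sum>i\<in>S. \<Sum>n'<d. g n * g n' * (b n i * b n' i))"
      by (rule sum.swap)
    also have "\<dots> = (\<Sum>n<d. \<Sum>n'<d. \<Sum>i\<in>S. g n * g n' * (b n i * b n' i))"
      by (intro sum.cong refl sum.swap)
    also have "\<dots> = (\<Sum>n<d. \<Sum>n'<d. g n * g n' * (if n = n' then 1 else 0))"
      using assms by (intro sum.cong) (auto simp flip: sum_distrib_left)
    also have "\<dots> = (\<Sum>n<d. (g n)\<^sup>2)"
      by (simp add: power2_eq_square if_distrib cong: if_cong)
    finally show ?thesis .
  qed
  have "0 \<le> (\<Sum>i\<in>S. (a i - (\<Sum>n<d. g n * b n i))\<^sup>2)"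
    by (intro sum_nonneg) auto
  also have "\<dots> = (\<Sum>i\<in>S. (a i)\<^sup>2) - 2 * (\<Sum>i\<in>S. a i * (\<Sum>n<d. g n * b n i)) + (\<Sum>i\<in>S. (\<Sum>n<d. g n * b n i)\<^sup>2)"
    by (simp add: power2_diff sum.distrib sum_subtractf sum_distrib_left mult_ac)
  finally show ?thesis
    using cross square by (simp add: g_def)
qed

section \<open>Rounding fractional points\<close>

lemma cosh_le_one_plus_square:
  fixes z :: real
  assumes "\<bar>z\<bar> \<le> 1"
  shows "cosh z \<le> 1 + z\<^sup>2"
proof -
  have *: "cosh u \<le> 1 + u\<^sup>2" if "0 \<le> u" "u \<le> 1" for u :: real
  proof -
    have "1 + u \<le> exp u" by (rule exp_ge_add_one_self)
    then have "exp (-u) \<le> 1 / (1 + u)"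
      using that by (simp add: exp_minus field_simps)
    also have "\<dots> \<le> 1 - u + u\<^sup>2"
    proof -
      have "(1 - u + u\<^sup>2) * (1 + u) = 1 + u ^ 3"
        by (simp add: algebra_simps power2_eq_square power3_eq_cube)
      then have "1 \<le> (1 - u + u\<^sup>2) * (1 + u)" using that by simp
      then show ?thesis using that by (simp add: divide_le_eq)
    qed
    finally show ?thesis
      using exp_bound[of u] that by (simp add: cosh_def)
  qed
  show ?thesis
    using *[of "\<bar>z\<bar>"] assms by (simp add: cosh_real_abs)
qed

text \<open>Maximise the norm over the points of the cube with the prescribed row sums. If no
  coordinate reached the boundary, the maximizer could be moved by a small multiple of a kernel
  vector in both directions, and by the parallelogram identity one of the two points would be
  longer.\<close>

lemma round_one_coordinate:
  fixes a :: "'j \<Rightarrow> 'i \<Rightarrow> real"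
  assumes "finite S" "finite R" "card R < card S" "\<And>i. i \<in> S \<Longrightarrow> \<bar>x0 i\<bar> \<le> 1"
  obtains x where "\<And>i. i \<in> S \<Longrightarrow> \<bar>x i\<bar> \<le> 1" "\<And>i. i \<notin> S \<Longrightarrow> x i = x0 i"
    "\<And>j. j \<in> R \<Longrightarrow> (\<Sum>i\<in>S. a j i * (x i - x0 i)) = 0" "\<exists>i\<in>S. \<bar>x i\<bar> = 1"
proof -
  define Q where "Q = {x. \<forall>j\<in>R. (\<Sum>i\<in>S. a j i * (x i - x0 i)) = 0}"
  have "Q = (\<Inter>j\<in>R. {x. (\<Sum>i\<in>S. a j i * (x i - x0 i)) = 0})"
    by (auto simp: Q_def)
  moreover have "closed \<dots>"
    by (intro closed_INT ballI closed_Collect_eq continuous_intros continuous_on_product_coordinates)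
  ultimately have "closed Q" by simp
  moreover have "x0 \<in> Q" by (simp add: Q_def)
  ultimately obtain x where x: "x \<in> Q" "\<And>i. i \<in> S \<Longrightarrow> \<bar>x i\<bar> \<le> 1" "\<And>i. i \<notin> S \<Longrightarrow> x i = x0 i"
    "\<And>y. y \<in> Q \<Longrightarrow> (\<And>i. i \<in> S \<Longrightarrow> \<bar>y i\<bar> \<le> 1) \<Longrightarrow> (\<And>i. i \<notin> S \<Longrightarrow> y i = x0 i) \<Longrightarrow>
      (\<Sum>i\<in>S. (y i)\<^sup>2) \<le> (\<Sum>i\<in>S. (x i)\<^sup>2)"
    using cube_norm_maximizer[of Q x0 S] assms(4) by blast
  have "\<exists>i\<in>S. \<bar>x i\<bar> = 1"
  proof (rule ccontr)
    assume no: "\<not> ?thesis"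
    obtain b where b: "\<exists>i\<in>S. b i \<noteq> 0" "\<And>i. i \<notin> S \<Longrightarrow> b i = 0" "\<And>j. j \<in> R \<Longrightarrow> (\<Sum>i\<in>S. a j i * b i) = 0"
      using homogeneous_solution[of R S a] assms by blast
    have pos: "(\<Sum>i\<in>S. (b i)\<^sup>2) > 0"
      using b(1) assms(1) by (metis sum_pos2 zero_le_power2 zero_less_power2)
    have small: "\<forall>\<^sub>F \<delta> in at_right 0. \<forall>i\<in>S. \<delta> * \<bar>b i\<bar> < 1 - \<bar>x i\<bar>"
    proof (rule eventually_ball_finite[OF assms(1)], rule ballI)
      fix i assume "i \<in> S"
      then have "\<bar>x i\<bar> < 1" using no x(2)[of i] by force
      moreover have "((\<lambda>\<delta>. \<delta> * \<bar>b i\<bar>) \<longlongrightarrow> 0 * \<bar>b i\<bar>) (at_right 0)"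
        by (intro tendsto_intros)
      ultimately show "\<forall>\<^sub>F \<delta> in at_right 0. \<delta> * \<bar>b i\<bar> < 1 - \<bar>x i\<bar>"
        by (intro order_tendstoD(2)) auto
    qed
    have "\<forall>\<^sub>F \<delta>::real in at_right 0. 0 < \<delta>"
      by (rule eventually_at_right_less)
    with small have "\<forall>\<^sub>F \<delta> in at_right 0. 0 < \<delta> \<and> (\<forall>i\<in>S. \<delta> * \<bar>b i\<bar> < 1 - \<bar>x i\<bar>)"
      by eventually_elim blast
    then obtain \<delta> where \<delta>: "0 < \<delta>" "\<And>i. i \<in> S \<Longrightarrow> \<delta> * \<bar>b i\<bar> < 1 - \<bar>x i\<bar>"
      using eventually_happens trivial_limit_at_right_real by blast
    have le: "(\<Sum>i\<in>S. (x i + \<sigma> * \<delta> * b i)\<^sup>2) \<le> (\<Sum>i\<in>S. (x i)\<^sup>2)" if "\<bar>\<sigma>\<bar> = 1" for \<sigma>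
    proof (rule x(4))
      have "(\<Sum>i\<in>S. a j i * (x i + \<sigma> * \<delta> * b i - x0 i)) = 0" if "j \<in> R" for j
      proof -
        have "(\<Sum>i\<in>S. a j i * (x i + \<sigma> * \<delta> * b i - x0 i))
            = (\<Sum>i\<in>S. a j i * (x i - x0 i)) + \<sigma> * \<delta> * (\<Sum>i\<in>S. a j i * b i)"
          by (simp add: algebra_simps sum.distrib sum_subtractf sum_distrib_left)
        then show ?thesis using x(1) b(3) that by (simp add: Q_def)
      qed
      then show "(\<lambda>i. x i + \<sigma> * \<delta> * b i) \<in> Q" by (simp add: Q_def)
      show "\<bar>x i + \<sigma> * \<delta> * b i\<bar> \<le> 1" if "i \<in> S" for i
      proof -
        have "\<bar>\<sigma> * \<delta> * b i\<bar> = \<delta> * \<bar>b i\<bar>" using \<open>\<bar>\<sigma>\<bar> = 1\<close> \<delta>(1) by (simp add: abs_mult)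
        then show ?thesis using \<delta>(2)[OF that] abs_triangle_ineq[of "x i" "\<sigma> * \<delta> * b i"] by linarith
      qed
      show "x i + \<sigma> * \<delta> * b i = x0 i" if "i \<notin> S" for i
        using that b(2) x(3) by simp
    qed
    have "(\<Sum>i\<in>S. (x i + 1 * \<delta> * b i)\<^sup>2) + (\<Sum>i\<in>S. (x i + (-1) * \<delta> * b i)\<^sup>2)
        = 2 * (\<Sum>i\<in>S. (x i)\<^sup>2) + 2 * \<delta>\<^sup>2 * (\<Sum>i\<in>S. (b i)\<^sup>2)"
      by (simp add: power2_eq_square algebra_simps sum.distrib sum_subtractf sum_distrib_left)
    moreover have "\<delta>\<^sup>2 * (\<Sum>i\<in>S. (b i)\<^sup>2) > 0"
      using pos \<delta>(1) by simp
    ultimately show False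
      using le[of 1] le[of "-1"] by linarith
  qed
  then show thesis
    using x(1-3) by (intro that[of x]) (auto simp: Q_def)
qed

text \<open>As long as more than \<open>n\<close> coordinates are fractional, there are fewer rows
  of weight above \<open>r\<close> than coordinates, so those rows can be kept exactly constant
  while one more coordinate is rounded. There are two uses: \<open>r = 0\<close> with
  \<open>n = m\<close> reduces the number of fractional coordinates at no cost, and
  \<open>n = 0\<close> finishes the rounding.\<close>

lemma beck_fiala_rounding:
  fixes a :: "'j \<Rightarrow> 'i \<Rightarrow> real"
  assumes "finite S" "finite R" "0 \<le> r" "\<And>i. i \<in> S \<Longrightarrow> \<bar>x0 i\<bar> \<le> 1"
    and "\<And>T. T \<subseteq> S \<Longrightarrow> n < card T \<Longrightarrow> card {j\<in>R. r < (\<Sum>i\<in>T. \<bar>a j i\<bar>)} < card T"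
  shows "\<exists>x. (\<forall>i\<in>S. \<bar>x i\<bar> \<le> 1) \<and> (\<forall>i. i \<notin> S \<longrightarrow> x i = x0 i) \<and> card {i\<in>S. \<bar>x i\<bar> \<noteq> 1} \<le> n \<and>
    (\<forall>j\<in>R. \<bar>\<Sum>i\<in>S. a j i * (x i - x0 i)\<bar> \<le> 2 * r)"
  using assms
proof (induction "card S" arbitrary: S x0 rule: less_induct)
  case less
  show ?case
  proof (cases "card S \<le> n")
    case True
    have "card {i\<in>S. \<bar>x0 i\<bar> \<noteq> 1} \<le> card S"
      using less.prems(1) by (intro card_mono) auto
    then show ?thesis
      using True less.prems(3,4) by (intro exI[of _ x0]) auto
  next
    case False
    define H where "H = {j\<in>R. r < (\<Sum>i\<in>S. \<bar>a j i\<bar>)}"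
    have H: "finite H" "card H < card S"
      using less.prems(5)[of S] less.prems(2) False by (auto simp: H_def)
    obtain y where y: "\<And>i. i \<in> S \<Longrightarrow> \<bar>y i\<bar> \<le> 1" "\<And>i. i \<notin> S \<Longrightarrow> y i = x0 i"
      "\<And>j. j \<in> H \<Longrightarrow> (\<Sum>i\<in>S. a j i * (y i - x0 i)) = 0" "\<exists>i\<in>S. \<bar>y i\<bar> = 1"
      using round_one_coordinate[OF less.prems(1) H, where a = a and ?x0.0 = x0] less.prems(4) by blast
    define T where "T = {i\<in>S. \<bar>y i\<bar> \<noteq> 1}"
    have T: "T \<subseteq> S" "T \<noteq> S" "finite T" using y(4) less.prems(1) by (auto simp: T_def)
    have "card T < card S" using T less.prems(1) by (intro psubset_card_mono) auto
    moreover have "\<bar>y i\<bar> \<le> 1" if "i \<in> T" for i using that y(1) T by auto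
    moreover have "card {j\<in>R. r < (\<Sum>i\<in>T'. \<bar>a j i\<bar>)} < card T'" if "T' \<subseteq> T" "n < card T'" for T'
      using less.prems(5)[of T'] that T by auto
    ultimately have "\<exists>x. (\<forall>i\<in>T. \<bar>x i\<bar> \<le> 1) \<and> (\<forall>i. i \<notin> T \<longrightarrow> x i = y i) \<and> card {i\<in>T. \<bar>x i\<bar> \<noteq> 1} \<le> n \<and>
        (\<forall>j\<in>R. \<bar>\<Sum>i\<in>T. a j i * (x i - y i)\<bar> \<le> 2 * r)"
      using T(3) less.prems(2,3) by (intro less.hyps)
    then obtain x where x: "\<And>i. i \<in> T \<Longrightarrow> \<bar>x i\<bar> \<le> 1" "\<And>i. i \<notin> T \<Longrightarrow> x i = y i"
      "card {i\<in>T. \<bar>x i\<bar> \<noteq> 1} \<le> n" "\<And>j. j \<in> R \<Longrightarrow> \<bar>\<Sum>i\<in>T. a j i * (x i - y i)\<bar> \<le> 2 * r"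
      by blast
    have cube: "\<bar>x i\<bar> \<le> 1" if "i \<in> S" for i
      using that x(1,2) y(1) by (cases "i \<in> T") auto
    have "{i\<in>S. \<bar>x i\<bar> \<noteq> 1} = {i\<in>T. \<bar>x i\<bar> \<noteq> 1}"
      using x(2) T(1) by (auto simp: T_def)
    moreover have "\<bar>\<Sum>i\<in>S. a j i * (x i - x0 i)\<bar> \<le> 2 * r" if "j \<in> R" for j
    proof (cases "j \<in> H")
      case True
      have "(\<Sum>i\<in>S. a j i * (x i - x0 i)) = (\<Sum>i\<in>S. a j i * (x i - y i)) + (\<Sum>i\<in>S. a j i * (y i - x0 i))"
        by (simp add: algebra_simps flip: sum.distrib)
      also have "(\<Sum>i\<in>S. a j i * (x i - y i)) = (\<Sum>i\<in>T. a j i * (x i - y i))"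
        using T x(2) less.prems(1) by (intro sum.mono_neutral_right) auto
      finally show ?thesis using y(3)[OF True] x(4)[OF that] by simp
    next
      case False
      \<comment> \<open>A row that is light now may be ignored for good: whatever the recursion
        does, each coordinate of \<open>S\<close> moves by at most 2 in total.\<close>
      have "\<bar>\<Sum>i\<in>S. a j i * (x i - x0 i)\<bar> \<le> (\<Sum>i\<in>S. \<bar>a j i * (x i - x0 i)\<bar>)"
        by (rule sum_abs)
      also have "\<dots> \<le> (\<Sum>i\<in>S. \<bar>a j i\<bar> * 2)"
      proof (intro sum_mono)
        fix i assume "i \<in> S"
        then have "\<bar>x i - x0 i\<bar> \<le> 2" using cube[of i] less.prems(4)[of i] by linarith
        then show "\<bar>a j i * (x i - x0 i)\<bar> \<le> \<bar>a j i\<bar> * 2"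
          by (auto simp: abs_mult intro: mult_left_mono)
      qed
      also have "\<dots> \<le> 2 * r"
        using False that by (simp add: H_def flip: sum_distrib_right)
      finally show ?thesis .
    qed
    moreover have "x i = x0 i" if "i \<notin> S" for i
      using that x(2) y(2) T(1) by (metis subsetD)
    ultimately show ?thesis
      using x(3) cube by (intro exI[of _ x]) auto
  qed
qed

section \<open>Partial coloring by a potential function\<close>

lemma partial_coloring:
  fixes a :: "'j \<Rightarrow> 'i \<Rightarrow> real" and M r :: real
  assumes S: "finite S" "8 \<le> card S" and R: "finite R" "real (card R) \<le> M" "real (card S) \<le> M"
    and cube: "\<And>i. i \<in> S \<Longrightarrow> \<bar>x0 i\<bar> \<le> 1"
    and B: "B \<subseteq> R" "100 * card B \<le> card S"
    and r: "0 < r" "\<And>j. j \<in> R - B \<Longrightarrow> (\<Sum>i\<in>S. (a j i)\<^sup>2) \<le> r"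
  shows "\<exists>x. (\<forall>i\<in>S. \<bar>x i\<bar> \<le> 1) \<and> (\<forall>i. i \<notin> S \<longrightarrow> x i = x0 i) \<and>
    2 * card {i\<in>S. \<bar>x i\<bar> \<noteq> 1} \<le> card S \<and>
    (\<forall>j\<in>B. (\<Sum>i\<in>S. a j i * (x i - x0 i)) = 0) \<and>
    (\<forall>j\<in>R-B. \<bar>\<Sum>i\<in>S. a j i * (x i - x0 i)\<bar> \<le> 9 * sqrt (r * ln (400 * M / card S)))"
proof -
  \<comment> \<open>Take x of maximal norm among the points where the potential, a sum of cosh over the light
    rows, has grown at most like exp(c |x|^2). If more than half of the coordinates of x were
    fractional, x could be perturbed in both directions along an orthonormal family orthogonal
    to x and to the heavy and tight rows; by Bessel's inequality, one of these perturbations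
    respects the potential, and all of them increase the norm.\<close>
  define s where "s = real (card S)"
  \<comment> \<open>The parameters are balanced so that
    \<open>\<eta>\<^sup>2 * r = \<Lambda>\<close> and \<open>c * s = 8 * \<Lambda>\<close>: as the
    squared norm grows by at most \<open>s\<close>, the potential gains at most a factor exp(8
    \<open>\<Lambda>\<close>). A row at the cap has \<open>\<eta> * \<beta> = 9 * \<Lambda>\<close>,
    one \<open>\<Lambda>\<close> above this budget, and the 400 makes that surplus large enough to
    leave at most s/200 such rows.\<close>
  define \<Lambda> where "\<Lambda> = ln (400 * M / s)"
  define \<eta> where "\<eta> = sqrt (\<Lambda> / r)"
  define \<beta> where "\<beta> = 9 * sqrt (r * \<Lambda>)"
  define c where "c = 8 * \<Lambda> / s"
  define y where "y = (\<lambda>j x. \<Sum>i\<in>S. a j i * (x i - x0 i))"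
  define \<Phi> where "\<Phi> = (\<lambda>x. \<Sum>j\<in>R-B. cosh (\<eta> * y j x))"
  define N where "N = (\<lambda>x :: 'i \<Rightarrow> real. \<Sum>i\<in>S. (x i)\<^sup>2)"
  \<comment> \<open>The cap \<open>\<beta>\<close> is imposed separately because the potential alone
    would bound a single row only with ln \<open>M\<close> in place of ln(M/s). The potential serves
    to show that few rows reach the cap.\<close>
  define Q where "Q = {x. (\<forall>j\<in>B. y j x = 0) \<and> (\<forall>j\<in>R-B. \<bar>y j x\<bar> \<le> \<beta>) \<and>
     \<Phi> x * exp (- c * N x) \<le> \<Phi> x0 * exp (- c * N x0)}"
  have s: "s \<ge> 8" "s \<le> M" using S R by (auto simp: s_def)
  have "400 * M / s \<ge> 400" using s by (simp add: field_simps)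
  then have \<Lambda>: "\<Lambda> > 0" unfolding \<Lambda>_def by (intro ln_gt_zero) linarith
  have \<eta>\<beta>: "\<eta> * \<beta> = 9 * \<Lambda>"
    using \<Lambda> r(1) by (simp add: \<eta>_def \<beta>_def real_sqrt_divide real_sqrt_mult)
  have \<eta>2: "\<eta>\<^sup>2 * r = \<Lambda>"
    using \<Lambda> r(1) by (simp add: \<eta>_def)
  have \<eta>: "\<eta> > 0" and \<beta>: "\<beta> > 0"
    using \<Lambda> r(1) by (auto simp: \<eta>_def \<beta>_def)
  have c: "c > 0" using \<Lambda> s by (simp add: c_def)
  have \<Phi>_nonneg: "\<Phi> x \<ge> 0" for x
    unfolding \<Phi>_def by (intro sum_nonneg) (simp add: cosh_real_nonneg)
  have cont_y: "continuous_on UNIV (y j)" for j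
    unfolding y_def by (intro continuous_intros continuous_on_product_coordinates)
  have cont_N: "continuous_on UNIV N"
    unfolding N_def by (intro continuous_intros continuous_on_product_coordinates)
  have cont_\<Phi>: "continuous_on UNIV \<Phi>"
    unfolding \<Phi>_def by (intro continuous_intros cont_y)
  have "Q = (\<Inter>j\<in>B. {x. y j x = 0}) \<inter> (\<Inter>j\<in>R-B. {x. \<bar>y j x\<bar> \<le> \<beta>}) \<inter>
      {x. \<Phi> x * exp (- c * N x) \<le> \<Phi> x0 * exp (- c * N x0)}"
    by (auto simp: Q_def)
  moreover have "closed \<dots>"
    by (intro closed_Int closed_INT ballI closed_Collect_eq closed_Collect_le continuous_intros
        cont_y cont_N cont_\<Phi>)
  ultimately have "closed Q" by simp
  moreover have "x0 \<in> Q"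
    using \<beta> by (auto simp: Q_def y_def)
  ultimately obtain x where x: "x \<in> Q" "\<And>i. i \<in> S \<Longrightarrow> \<bar>x i\<bar> \<le> 1" "\<And>i. i \<notin> S \<Longrightarrow> x i = x0 i"
    and x_max: "\<And>z. z \<in> Q \<Longrightarrow> (\<And>i. i \<in> S \<Longrightarrow> \<bar>z i\<bar> \<le> 1) \<Longrightarrow> (\<And>i. i \<notin> S \<Longrightarrow> z i = x0 i) \<Longrightarrow> N z \<le> N x"
    using cube_norm_maximizer[of Q x0 S] cube unfolding N_def by blast
  have xQ: "\<And>j. j \<in> B \<Longrightarrow> y j x = 0" "\<And>j. j \<in> R - B \<Longrightarrow> \<bar>y j x\<bar> \<le> \<beta>"
    "\<Phi> x * exp (- c * N x) \<le> \<Phi> x0 * exp (- c * N x0)"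
    using x(1) by (auto simp: Q_def)
  define F where "F = {i\<in>S. \<bar>x i\<bar> \<noteq> 1}"
  have F: "finite F" "F \<subseteq> S" using S by (auto simp: F_def)
  have "2 * card F \<le> card S"
  proof (rule ccontr)
    assume "\<not> 2 * card F \<le> card S"
    then have F_large: "2 * real (card F) \<ge> s + 1" unfolding s_def by linarith

    define Z where "Z = {j\<in>R-B. \<bar>y j x\<bar> = \<beta>}"
    have Z: "finite Z" "Z \<subseteq> R - B" using R by (auto simp: Z_def)
    \<comment> \<open>Each tight row contributes at least exp(9 \<open>\<Lambda>\<close>)/2 to a
      potential that starts at most at \<open>M\<close> and has grown by at most exp(8
      \<open>\<Lambda>\<close>).\<close>
    have "real (card Z) \<le> s / 200"
    proof -
      have "\<Phi> x0 = real (card (R - B))" by (simp add: \<Phi>_def y_def)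
      also have "\<dots> \<le> real (card R)" using R by (intro of_nat_mono card_mono) auto
      finally have "\<Phi> x0 \<le> M" using R by simp
      have "N x \<le> (\<Sum>i\<in>S. 1)"
        unfolding N_def using x(2) by (intro sum_mono) (simp add: abs_square_le_1)
      moreover have "N x0 \<ge> 0" unfolding N_def by (intro sum_nonneg) auto
      ultimately have "c * (N x - N x0) \<le> c * s"
        using c by (intro mult_left_mono) (auto simp: s_def)
      also have "c * s = 8 * \<Lambda>" using s by (simp add: c_def)
      finally have expo: "c * (N x - N x0) \<le> 8 * \<Lambda>" .
      have "\<Phi> x = \<Phi> x * exp (- c * N x) * exp (c * N x)"
        by (simp add: mult.assoc flip: exp_add)
      also have "\<dots> \<le> \<Phi> x0 * exp (- c * N x0) * exp (c * N x)"
        using xQ(3) by (intro mult_right_mono) auto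
      also have "\<dots> = \<Phi> x0 * exp (c * (N x - N x0))"
        by (simp add: algebra_simps flip: exp_add)
      also have "\<dots> \<le> M * exp (8 * \<Lambda>)"
        using \<open>\<Phi> x0 \<le> M\<close> expo \<Phi>_nonneg s by (intro mult_mono) auto
      finally have \<Phi>_le: "\<Phi> x \<le> M * exp (8 * \<Lambda>)" .
      have "cosh (\<eta> * y j x) \<ge> exp (9 * \<Lambda>) / 2" if "j \<in> Z" for j
      proof -
        have "cosh (\<eta> * y j x) = cosh \<bar>\<eta> * y j x\<bar>" by (simp add: cosh_real_abs)
        also have "\<bar>\<eta> * y j x\<bar> = 9 * \<Lambda>" using that \<eta> \<eta>\<beta> by (simp add: Z_def abs_mult)
        finally have eq: "cosh (\<eta> * y j x) = cosh (9 * \<Lambda>)" .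
        show ?thesis unfolding eq by (simp add: cosh_def)
      qed
      then have "real (card Z) * (exp (9 * \<Lambda>) / 2) \<le> (\<Sum>j\<in>Z. cosh (\<eta> * y j x))"
        by (intro sum_bounded_below) auto
      also have "\<dots> \<le> \<Phi> x"
        unfolding \<Phi>_def using Z R by (intro sum_mono2) (auto simp: cosh_real_nonneg)
      finally have "real (card Z) * (exp (9 * \<Lambda>) / 2) \<le> M * exp (8 * \<Lambda>)" using \<Phi>_le by simp
      also have "exp (9 * \<Lambda>) = exp (8 * \<Lambda>) * exp \<Lambda>" by (simp flip: exp_add)
      finally have "exp (8 * \<Lambda>) * (real (card Z) * exp \<Lambda>) \<le> exp (8 * \<Lambda>) * (2 * M)"
        by (simp add: algebra_simps)
      then have "real (card Z) * exp \<Lambda> \<le> 2 * M" by simp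
      also have "exp \<Lambda> = 400 * M / s"
        using s by (simp add: \<Lambda>_def)
      finally show ?thesis using s by (simp add: field_simps)
    qed

    define C where "C = a ` B \<union> a ` Z \<union> {x}"
    have "finite B" using B(1) R(1) finite_subset by blast
    have "card C \<le> card (a ` B \<union> a ` Z) + card {x}" unfolding C_def by (rule card_Un_le)
    also have "\<dots> \<le> card (a ` B) + card (a ` Z) + 1" using card_Un_le by simp
    also have "\<dots> \<le> card B + card Z + 1"
      using card_image_le[of B a] card_image_le[of Z a] \<open>finite B\<close> Z by simp
    finally have "real (card C) \<le> real (card B) + real (card Z) + 1" by linarith
    also have "\<dots> \<le> s / 100 + s / 200 + 1"
      using \<open>real (card Z) \<le> s / 200\<close> B(2) by (simp add: s_def)
    finally have card_C: "real (card C) \<le> s / 100 + s / 200 + 1" .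
    \<comment> \<open>This is s/8 rounded up. It is small enough to fit beside the constraints in
      the more than s/2 fractional coordinates (using s at least 8), and large enough that
      \<open>real d * c\<close> is at least \<open>\<Lambda>\<close>, which the final comparison
      needs.\<close>
    define d where "d = (card S + 7) div 8"
    have "8 * d \<ge> card S" "8 * d \<le> card S + 7" unfolding d_def by auto
    then have d: "8 * real d \<ge> s" "8 * real d \<le> s + 7" unfolding s_def by linarith+
    then have "d > 0" using s by (cases d) auto
    have "real (card C + d) \<le> real (card F)"
      using card_C F_large d s by simp
    then have "card C + d \<le> card F" by linarith
    moreover have "finite C" using \<open>finite B\<close> Z by (simp add: C_def)
    ultimately obtain b :: "nat \<Rightarrow> 'i \<Rightarrow> real" where
      bF: "\<forall>n<d. (\<forall>i. i \<notin> F \<longrightarrow> b n i = 0) \<and> (\<forall>v\<in>C. (\<Sum>i\<in>F. v i * b n i) = 0)"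
      and orthF: "\<forall>n<d. \<forall>n'<d. (\<Sum>i\<in>F. b n i * b n' i) = (if n = n' then 1 else 0)"
      using orthonormal_family[of C F d] F by blast
    have b0: "b n i = 0" if "n < d" "i \<notin> F" for n i using that bF by blast
    have sum_F: "(\<Sum>i\<in>S. v i * b n i) = (\<Sum>i\<in>F. v i * b n i)" if "n < d" for v n
      using F S b0[OF that] by (intro sum.mono_neutral_right) auto
    have bC: "(\<Sum>i\<in>S. v i * b n i) = 0" if "n < d" "v \<in> C" for v n
      using that bF sum_F by auto
    have orth: "(\<Sum>i\<in>S. b n i * b n' i) = (if n = n' then 1 else 0)" if "n < d" "n' < d" for n n'
      using that orthF sum_F by auto
    have b_le: "\<bar>b n i\<bar> \<le> 1" if "n < d" for n i
    proof (cases "i \<in> S")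
      case True
      have "(b n i)\<^sup>2 \<le> (\<Sum>i\<in>S. (b n i)\<^sup>2)"
        using S True by (intro member_le_sum) auto
      also have "\<dots> = 1" using orth[OF that that] by (simp add: power2_eq_square)
      finally show ?thesis by (simp add: abs_square_le_1)
    next
      case False
      then have "i \<notin> F" using F by blast
      then show ?thesis using b0[OF that] by simp
    qed
    define p where "p = (\<lambda>j n. \<Sum>i\<in>S. a j i * b n i)"
    have bessel: "(\<Sum>n<d. (p j n)\<^sup>2) \<le> r" if "j \<in> R - B" for j
      using bessel_inequality[of d b S "a j"] orth r(2)[OF that] unfolding p_def by force
    have p_le: "\<bar>p j n\<bar> \<le> sqrt r" if "j \<in> R - B" "n < d" for j n
    proof -
      have "(p j n)\<^sup>2 \<le> (\<Sum>n<d. (p j n)\<^sup>2)"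
        using that by (intro member_le_sum) auto
      then have "(p j n)\<^sup>2 \<le> r" using bessel[OF that(1)] by linarith
      then show ?thesis using real_le_rsqrt real_sqrt_le_iff by (metis real_sqrt_abs)
    qed
    have p0: "p j n = 0" if "j \<in> B \<union> Z" "n < d" for j n
      using bC[OF that(2), of "a j"] that by (auto simp: p_def C_def)

    have small: "\<forall>\<^sub>F \<delta> in at_right 0. \<delta> * u < e" if "e > 0" for u e :: real
    proof -
      have "((\<lambda>\<delta>. \<delta> * u) \<longlongrightarrow> 0 * u) (at_right 0)" by (intro tendsto_intros)
      then show ?thesis using that by (intro order_tendstoD(2)) auto
    qed
    have pos: "\<forall>\<^sub>F \<delta>::real in at_right 0. 0 < \<delta>"
      by (rule eventually_at_right_less)
    have F_lt: "0 < 1 - \<bar>x i\<bar>" if "i \<in> F" for i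
      using that x(2)[of i] F by (force simp: F_def)
    have Z_lt: "0 < \<beta> - \<bar>y j x\<bar>" if "j \<in> R - B - Z" for j
      using that xQ(2)[of j] by (force simp: Z_def)
    \<comment> \<open>One step length has to serve all directions: fractional coordinates stay in
      the cube, rows below the cap stay below it, and the increments inside cosh stay within the
      range of the quadratic bound.\<close>
    have "\<forall>\<^sub>F \<delta> in at_right 0. \<forall>i\<in>F. \<delta> * 1 < 1 - \<bar>x i\<bar>"
      using F by (intro eventually_ball_finite ballI small F_lt) auto
    moreover have "\<forall>\<^sub>F \<delta> in at_right 0. \<forall>j\<in>R-B-Z. \<delta> * sqrt r < \<beta> - \<bar>y j x\<bar>"
      using R by (intro eventually_ball_finite ballI small Z_lt) auto
    moreover have "\<forall>\<^sub>F \<delta> in at_right 0. \<delta> * (\<eta> * sqrt r) < 1"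
      by (rule small) simp
    ultimately have "\<forall>\<^sub>F \<delta> in at_right 0. 0 < \<delta> \<and> (\<forall>i\<in>F. \<delta> * 1 < 1 - \<bar>x i\<bar>) \<and>
        (\<forall>j\<in>R-B-Z. \<delta> * sqrt r < \<beta> - \<bar>y j x\<bar>) \<and> \<delta> * (\<eta> * sqrt r) < 1"
      using pos by eventually_elim blast
    from eventually_happens'[OF _ this] obtain \<delta> where \<delta>': "0 < \<delta> \<and> (\<forall>i\<in>F. \<delta> * 1 < 1 - \<bar>x i\<bar>) \<and>
        (\<forall>j\<in>R-B-Z. \<delta> * sqrt r < \<beta> - \<bar>y j x\<bar>) \<and> \<delta> * (\<eta> * sqrt r) < 1"
      by auto
    then have \<delta>: "0 < \<delta>" "\<And>i. i \<in> F \<Longrightarrow> \<delta> < 1 - \<bar>x i\<bar>"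
      "\<And>j. j \<in> R - B - Z \<Longrightarrow> \<delta> * sqrt r < \<beta> - \<bar>y j x\<bar>" "\<delta> * (\<eta> * sqrt r) < 1"
      by simp_all

    define z where "z = (\<lambda>n \<sigma> i. x i + \<sigma> * \<delta> * b n i)"
    have y_z: "y j (z n \<sigma>) = y j x + \<sigma> * \<delta> * p j n" for j n \<sigma>
      by (simp add: y_def z_def p_def algebra_simps sum.distrib sum_subtractf sum_distrib_left)
    have N_z: "N (z n \<sigma>) = N x + \<delta>\<^sup>2" if "n < d" "\<bar>\<sigma>\<bar> = 1" for n \<sigma>
    proof -
      have "\<sigma>\<^sup>2 = 1" using that(2) by (metis power2_abs one_power2)
      have "N (z n \<sigma>) = N x + 2 * \<sigma> * \<delta> * (\<Sum>i\<in>S. x i * b n i) + \<sigma>\<^sup>2 * \<delta>\<^sup>2 * (\<Sum>i\<in>S. b n i * b n i)"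
        by (simp add: N_def z_def power2_eq_square algebra_simps sum.distrib sum_distrib_left)
      then show ?thesis
        using bC[OF that(1), of x] orth[OF that(1) that(1)] \<open>\<sigma>\<^sup>2 = 1\<close> by (simp add: C_def)
    qed
    \<comment> \<open>The perturbed point is longer than \<open>x\<close>, hence cannot lie in
      \<open>Q\<close>. It stays in the cube and respects the heavy rows and the cap, so the
      constraint on the potential is the one that fails.\<close>
    have grow: "\<Phi> (z n \<sigma>) > \<Phi> x * exp (c * \<delta>\<^sup>2)" if n: "n < d" and \<sigma>: "\<bar>\<sigma>\<bar> = 1" for n \<sigma>
    proof -
      have step: "\<bar>\<sigma> * \<delta> * q\<bar> = \<delta> * \<bar>q\<bar>" for q
        using \<sigma> \<delta>(1) by (simp add: abs_mult)
      have "\<bar>z n \<sigma> i\<bar> \<le> 1" if "i \<in> S" for i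
      proof (cases "i \<in> F")
        case True
        have "\<delta> * \<bar>b n i\<bar> \<le> \<delta> * 1" using \<delta>(1) b_le[OF n] by (intro mult_left_mono) auto
        then show ?thesis
          using abs_triangle_ineq[of "x i" "\<sigma> * \<delta> * b n i"] step[of "b n i"] \<delta>(2)[OF True]
          unfolding z_def by linarith
      next
        case False
        then show ?thesis using that x(2) b0[OF n] by (simp add: z_def)
      qed
      moreover have "z n \<sigma> i = x0 i" if "i \<notin> S" for i
        using that x(3) b0[OF n] F by (auto simp: z_def)
      moreover have "\<not> N (z n \<sigma>) \<le> N x" using N_z[OF n \<sigma>] \<delta>(1) by simp
      ultimately have "z n \<sigma> \<notin> Q" using x_max by blast
      moreover have "y j (z n \<sigma>) = 0" if "j \<in> B" for j
        using that xQ(1) p0[OF _ n] by (simp add: y_z)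
      moreover have "\<bar>y j (z n \<sigma>)\<bar> \<le> \<beta>" if "j \<in> R - B" for j
      proof (cases "j \<in> Z")
        case True
        then show ?thesis using xQ(2)[OF that] p0[OF _ n] by (simp add: y_z)
      next
        case False
        have "\<delta> * \<bar>p j n\<bar> \<le> \<delta> * sqrt r" using p_le[OF that n] \<delta>(1) by (intro mult_left_mono) auto
        moreover have "\<delta> * sqrt r < \<beta> - \<bar>y j x\<bar>" using that False by (intro \<delta>(3)) auto
        ultimately show ?thesis
          using abs_triangle_ineq[of "y j x" "\<sigma> * \<delta> * p j n"] step[of "p j n"]
          unfolding y_z by linarith
      qed
      ultimately have "\<Phi> x0 * exp (- c * N x0) < \<Phi> (z n \<sigma>) * exp (- c * N (z n \<sigma>))"
        by (auto simp: Q_def not_le)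
      then have "\<Phi> x * exp (- c * N x) < \<Phi> (z n \<sigma>) * exp (- c * N (z n \<sigma>))"
        using xQ(3) by linarith
      then have "\<Phi> x * exp (- c * N x) * exp (c * N (z n \<sigma>))
          < \<Phi> (z n \<sigma>) * exp (- c * N (z n \<sigma>)) * exp (c * N (z n \<sigma>))"
        by (intro mult_strict_right_mono) auto
      then show ?thesis
        by (simp add: N_z[OF n \<sigma>] mult.assoc algebra_simps flip: exp_add)
    qed

    \<comment> \<open>Adding the two opposite moves cancels the sinh terms, so only a second-order
      increase remains.\<close>
    have pair: "\<Phi> (z n 1) + \<Phi> (z n (-1)) \<le> (\<Sum>j\<in>R-B. 2 * cosh (\<eta> * y j x) * (1 + \<eta>\<^sup>2 * \<delta>\<^sup>2 * (p j n)\<^sup>2))"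
      if n: "n < d" for n
      unfolding \<Phi>_def sum.distrib[symmetric]
    proof (intro sum_mono)
      fix j assume j: "j \<in> R - B"
      define u where "u = \<eta> * \<delta> * p j n"
      have "\<bar>u\<bar> = \<delta> * \<eta> * \<bar>p j n\<bar>" using \<eta> \<delta>(1) by (simp add: u_def abs_mult)
      also have "\<dots> \<le> \<delta> * \<eta> * sqrt r" using p_le[OF j n] \<eta> \<delta>(1) by (intro mult_left_mono) auto
      finally have "\<bar>u\<bar> \<le> 1" using \<delta>(4) by (simp add: mult.assoc)
      have "cosh (\<eta> * y j (z n 1)) + cosh (\<eta> * y j (z n (-1)))
          = cosh (\<eta> * y j x + u) + cosh (\<eta> * y j x - u)"
        by (simp add: y_z u_def algebra_simps)
      also have "\<dots> = 2 * cosh (\<eta> * y j x) * cosh u"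
        by (simp add: cosh_add cosh_diff)
      also have "\<dots> \<le> 2 * cosh (\<eta> * y j x) * (1 + u\<^sup>2)"
        using cosh_le_one_plus_square[OF \<open>\<bar>u\<bar> \<le> 1\<close>]
        by (intro mult_left_mono) (auto simp: cosh_real_nonneg)
      finally show "cosh (\<eta> * y j (z n 1)) + cosh (\<eta> * y j (z n (-1)))
          \<le> 2 * cosh (\<eta> * y j x) * (1 + \<eta>\<^sup>2 * \<delta>\<^sup>2 * (p j n)\<^sup>2)"
        by (simp add: u_def power_mult_distrib mult.assoc)
    qed
    have "2 * real d * (\<Phi> x * exp (c * \<delta>\<^sup>2)) = (\<Sum>n<d. 2 * (\<Phi> x * exp (c * \<delta>\<^sup>2)))"
      by simp
    also have "\<dots> < (\<Sum>n<d. \<Phi> (z n 1) + \<Phi> (z n (-1)))"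
    proof (intro sum_strict_mono)
      fix n assume "n \<in> {..<d}"
      then show "2 * (\<Phi> x * exp (c * \<delta>\<^sup>2)) < \<Phi> (z n 1) + \<Phi> (z n (-1))"
        using grow[of n 1] grow[of n "-1"] by simp
    qed (use \<open>d > 0\<close> in auto)
    also have "\<dots> \<le> (\<Sum>n<d. \<Sum>j\<in>R-B. 2 * cosh (\<eta> * y j x) * (1 + \<eta>\<^sup>2 * \<delta>\<^sup>2 * (p j n)\<^sup>2))"
      using pair by (intro sum_mono) auto
    also have "\<dots> = (\<Sum>j\<in>R-B. \<Sum>n<d. 2 * cosh (\<eta> * y j x) * (1 + \<eta>\<^sup>2 * \<delta>\<^sup>2 * (p j n)\<^sup>2))"
      by (rule sum.swap)
    also have "\<dots> = (\<Sum>j\<in>R-B. 2 * cosh (\<eta> * y j x) * (real d + \<eta>\<^sup>2 * \<delta>\<^sup>2 * (\<Sum>n<d. (p j n)\<^sup>2)))"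
      by (simp add: sum.distrib flip: sum_distrib_left)
    \<comment> \<open>Bessel's inequality replaces the sum over all \<open>d\<close> directions by
      the single bound \<open>r\<close>. The total relative increase becomes
      \<open>\<Lambda> * \<delta>\<^sup>2\<close>, which \<open>d\<close> directions growing at rate
      \<open>c\<close> would exceed.\<close>
    also have "\<dots> \<le> (\<Sum>j\<in>R-B. 2 * cosh (\<eta> * y j x) * (real d + \<eta>\<^sup>2 * \<delta>\<^sup>2 * r))"
      using bessel by (intro sum_mono mult_left_mono add_left_mono) (auto simp: cosh_real_nonneg)
    also have "\<dots> = 2 * (real d + \<eta>\<^sup>2 * \<delta>\<^sup>2 * r) * \<Phi> x"
      unfolding \<Phi>_def sum_distrib_left by (intro sum.cong) (simp_all only: mult_ac)
    also have "\<eta>\<^sup>2 * \<delta>\<^sup>2 * r = \<Lambda> * \<delta>\<^sup>2" using \<eta>2 by (simp add: mult_ac)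
    also have "2 * (real d + \<Lambda> * \<delta>\<^sup>2) * \<Phi> x \<le> 2 * (real d * exp (c * \<delta>\<^sup>2)) * \<Phi> x"
    proof (intro mult_right_mono mult_left_mono \<Phi>_nonneg)
      have "\<Lambda> * s \<le> \<Lambda> * (8 * real d)" using \<Lambda> d by (intro mult_left_mono) auto
      then have "\<Lambda> \<le> real d * c" using s by (simp add: c_def field_simps)
      then have "\<Lambda> * \<delta>\<^sup>2 \<le> real d * c * \<delta>\<^sup>2" by (intro mult_right_mono) auto
      then have "real d + \<Lambda> * \<delta>\<^sup>2 \<le> real d * (1 + c * \<delta>\<^sup>2)" by (simp add: algebra_simps)
      also have "\<dots> \<le> real d * exp (c * \<delta>\<^sup>2)"
        by (intro mult_left_mono exp_ge_add_one_self) auto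
      finally show "real d + \<Lambda> * \<delta>\<^sup>2 \<le> real d * exp (c * \<delta>\<^sup>2)" .
    qed auto
    finally show False by (simp add: mult_ac)
  qed
  then show ?thesis
    using x(2,3) xQ(1,2) unfolding y_def F_def \<beta>_def \<Lambda>_def s_def by (intro exI[of _ x]) auto
qed

section \<open>Iterated halving and its geometric series\<close>

text \<open>The sum of the geometric series of the losses: the factor of one partial coloring is 9
  \<open>sqrt 5090\<close>, and halving the number of columns multiplies (s/m)^(1/8) by (1/2)^(1/8).
  Only its fixed-point equation is used in the recursion.\<close>

definition halving_const :: real where
  "halving_const = 9 * sqrt 5090 / (1 - (1/2) powr (1/8))"

lemma halving_const: "halving_const > 0"
    "9 * sqrt 5090 + halving_const * (1/2) powr (1/8) = halving_const"
proof -
  have "(1/2) powr (1/8) < (1::real)"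
    using powr_less_mono2[of "1/8" "1/2" "1::real"] by simp
  then show "halving_const > 0"
    "9 * sqrt 5090 + halving_const * (1/2) powr (1/8) = halving_const"
    by (auto simp: halving_const_def field_simps)
qed

text \<open>Put p = (s/m)^(1/8). The hypothesis \<open>m \<le> s * t\<close> says that t p^8 is at
  least 1, so \<open>sqrt t\<close> is at most t p^4 and both parts of the row size together are at
  most 509 t p^4. The logarithm is at most 10/p^2, since ln(1/p^2) is at most 1/p^2 - 1. The product
  5090 t p^2 has a square root that is still proportional to p.\<close>

lemma partial_coloring_bound_le:
  assumes "0 < s" "s \<le> m" "0 < t" "m \<le> s * t"
  shows "9 * sqrt ((9 * s * t / m + 500 * sqrt t) * ln (400 * m / s))
    \<le> 9 * sqrt 5090 * sqrt t * (s / m) powr (1/8)"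
proof -
  define p where "p = (s / m) powr (1/8)"
  have p: "p > 0" "p \<le> 1" using assms by (auto simp: p_def powr_le1)
  have p8: "p ^ 8 = s / m"
    using assms by (simp add: p_def powr_powr flip: powr_realpow)
  have "p ^ 8 \<le> p ^ 4" using p by (intro power_decreasing) auto
  then have "9 * s * t / m \<le> 9 * t * p ^ 4"
    using mult_left_mono[of "p ^ 8" "p ^ 4" "9 * t"] assms p8 by (simp add: mult_ac)
  moreover have "sqrt t \<le> t * p ^ 4"
  proof (rule real_le_lsqrt)
    have "1 \<le> t * p ^ 8" using assms by (simp add: p8 field_simps)
    then have "t * 1 \<le> t * (t * p ^ 8)" using assms by (intro mult_left_mono) auto
    also have "\<dots> = (t * p ^ 4)\<^sup>2" by (simp add: power2_eq_square power_mult_distrib flip: power_add)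
    finally show "t \<le> (t * p ^ 4)\<^sup>2" by simp
  qed (use p assms in auto)
  ultimately have size: "9 * s * t / m + 500 * sqrt t \<le> 509 * t * p ^ 4" by linarith
  have "ln (400::real) \<le> ln (2 ^ 9)" by (subst ln_le_cancel_iff) auto
  also have "\<dots> = 9 * ln 2" by (subst ln_realpow) auto
  also have "\<dots> \<le> 9" using ln_2_less_1 by simp
  finally have "ln (400::real) \<le> 9" .
  moreover have "ln (400 * m / s) = ln 400 + 4 * ln (1 / p\<^sup>2)"
  proof -
    have "400 * m / s = 400 / p ^ 8" using p8 p assms by (simp add: field_simps)
    then show ?thesis using p by (simp add: ln_div ln_realpow)
  qed
  moreover have "ln (1 / p\<^sup>2) \<le> 1 / p\<^sup>2 - 1" using p by (intro ln_le_minus_one) auto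
  moreover have "1 / p\<^sup>2 \<ge> 1" using p by (simp add: power_le_one)
  ultimately have logs: "ln (400 * m / s) \<le> 10 / p\<^sup>2" by simp
  have "400 * m / s \<ge> 1" using assms by (simp add: field_simps)
  then have "(9 * s * t / m + 500 * sqrt t) * ln (400 * m / s) \<le> 509 * t * p ^ 4 * (10 / p\<^sup>2)"
    using p assms by (intro mult_mono size logs) auto
  also have "\<dots> = 5090 * t * p\<^sup>2"
    using p by (simp add: field_simps power2_eq_square power4_eq_xxxx)
  finally have "sqrt ((9 * s * t / m + 500 * sqrt t) * ln (400 * m / s)) \<le> sqrt (5090 * t * p\<^sup>2)"
    by (rule real_sqrt_le_mono)
  also have "\<dots> = sqrt 5090 * sqrt t * p" using p by (simp add: real_sqrt_mult)
  finally show ?thesis by (simp add: p_def)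
qed

text \<open>The bound is the tail of the geometric series from the current size downwards, in the
  form that the induction reproduces; 1018 \<open>sqrt t\<close> is paid once, at the last stage.
  The ambient set \<open>X\<close> stays fixed while \<open>S\<close> shrinks, so the same goodness
  hypothesis serves every stage.\<close>

lemma full_coloring_few_columns:
  fixes a :: "nat \<Rightarrow> 'i \<Rightarrow> real" and m t :: nat
  assumes "0 < m" "0 < t" and a: "\<And>j i. j < m \<Longrightarrow> i \<in> X \<Longrightarrow> \<bar>a j i\<bar> \<le> 1"
    and good: "\<And>S. S \<subseteq> X \<Longrightarrow> S \<noteq> {} \<Longrightarrow> card S \<le> m \<Longrightarrow>
      100 * card {j\<in>{..<m}. 9 * real (card S) * real t / real m + 500 * sqrt t \<le> (\<Sum>i\<in>S. \<bar>a j i\<bar>)} < card S"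
    and S: "finite X" "S \<subseteq> X" "card S \<le> m" "\<And>i. i \<in> S \<Longrightarrow> \<bar>x0 i\<bar> \<le> 1"
  shows "\<exists>x. (\<forall>i\<in>S. \<bar>x i\<bar> = 1) \<and> (\<forall>i. i \<notin> S \<longrightarrow> x i = x0 i) \<and>
    (\<forall>j<m. \<bar>\<Sum>i\<in>S. a j i * (x i - x0 i)\<bar>
      \<le> halving_const * sqrt t * (card S / m) powr (1/8) + 1018 * sqrt t)"
  using S(2-4)
proof (induction "card S" arbitrary: S x0 rule: less_induct)
  case less
  have fin: "finite S" using less.prems(1) S(1) finite_subset by blast
  have t1: "sqrt t \<ge> 1" using assms(2) by simp
  show ?case
  proof (cases "card S \<le> 8 \<or> card S * t \<le> m")
    case True
    note small = True
    \<comment> \<open>The threshold is 9 + 500: once st is at most m, the first part of the goodness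
      threshold is at most 9, hence at most 9 \<open>sqrt t\<close>, for every subset
      \<open>T\<close>. With at most 8 columns no row is that heavy at all; this case is split off
      because partial coloring needs 8 columns.\<close>
    have few: "card {j\<in>{..<m}. 509 * sqrt t < (\<Sum>i\<in>T. \<bar>a j i\<bar>)} < card T" if T: "T \<subseteq> S" "0 < card T" for T
    proof -
      have le: "card T \<le> card S" using T fin by (intro card_mono)
      show ?thesis
      proof (cases "card S \<le> 8")
        case True
        have "(\<Sum>i\<in>T. \<bar>a j i\<bar>) \<le> 8" if "j < m" for j
        proof -
          have "(\<Sum>i\<in>T. \<bar>a j i\<bar>) \<le> (\<Sum>i\<in>T. 1)" using a that T less.prems(1) by (intro sum_mono) auto
          then show ?thesis using le True by simp
        qed
        then have "{j\<in>{..<m}. 509 * sqrt t < (\<Sum>i\<in>T. \<bar>a j i\<bar>)} = {}"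
          using t1 by (smt (verit) Collect_empty_eq lessThan_iff mem_Collect_eq empty_Collect_eq)
        then show ?thesis using T(2) by (simp only: card.empty)
      next
        case False
        then have "card S * t \<le> m" using small by simp
        then have "card T * t \<le> m" using le by (meson dual_order.trans mult_le_mono1)
        then have "real (card T) * real t \<le> real m" by (metis of_nat_le_iff of_nat_mult)
        then have "9 * real (card T) * real t / real m \<le> 9" using assms(1) by (simp add: field_simps)
        then have "9 * real (card T) * real t / real m + 500 * sqrt t \<le> 509 * sqrt t" using t1 by linarith
        then have "card {j\<in>{..<m}. 509 * sqrt t < (\<Sum>i\<in>T. \<bar>a j i\<bar>)}
            \<le> card {j\<in>{..<m}. 9 * real (card T) * real t / real m + 500 * sqrt t \<le> (\<Sum>i\<in>T. \<bar>a j i\<bar>)}"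
          by (intro card_mono) auto
        moreover have "100 * card {j\<in>{..<m}. 9 * real (card T) * real t / real m + 500 * sqrt t
            \<le> (\<Sum>i\<in>T. \<bar>a j i\<bar>)} < card T"
          using T less.prems le by (intro good) auto
        ultimately show ?thesis by linarith
      qed
    qed
    have "\<exists>x. (\<forall>i\<in>S. \<bar>x i\<bar> \<le> 1) \<and> (\<forall>i. i \<notin> S \<longrightarrow> x i = x0 i) \<and> card {i\<in>S. \<bar>x i\<bar> \<noteq> 1} \<le> 0 \<and>
      (\<forall>j\<in>{..<m}. \<bar>\<Sum>i\<in>S. a j i * (x i - x0 i)\<bar> \<le> 2 * (509 * sqrt t))"
      using fin less.prems few by (intro beck_fiala_rounding) auto
    then obtain x where x: "\<forall>i. i \<notin> S \<longrightarrow> x i = x0 i" "card {i\<in>S. \<bar>x i\<bar> \<noteq> 1} \<le> 0"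
      "\<forall>j\<in>{..<m}. \<bar>\<Sum>i\<in>S. a j i * (x i - x0 i)\<bar> \<le> 2 * (509 * sqrt t)" by blast
    have "0 \<le> halving_const * sqrt t * (card S / m) powr (1/8)"
      using halving_const(1) by simp
    then show ?thesis
      using x fin by (intro exI[of _ x]) force
  next
    case False
    then have S8: "card S > 8" and St: "real m \<le> real (card S) * real t"
      by (simp_all flip: of_nat_mult)
    define r where "r = 9 * real (card S) * real t / real m + 500 * sqrt t"
    define B where "B = {j\<in>{..<m}. r \<le> (\<Sum>i\<in>S. \<bar>a j i\<bar>)}"
    define \<beta> where "\<beta> = 9 * sqrt (r * ln (400 * real m / card S))"
    have "r > 0" using t1 by (simp add: r_def add_nonneg_pos)
    \<comment> \<open>Goodness controls absolute row sums, partial coloring needs sums of squares;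
      entries of absolute value at most 1 bridge the two.\<close>
    have sq: "(\<Sum>i\<in>S. (a j i)\<^sup>2) \<le> r" if "j \<in> {..<m} - B" for j
    proof -
      have "(\<Sum>i\<in>S. (a j i)\<^sup>2) \<le> (\<Sum>i\<in>S. \<bar>a j i\<bar>)"
      proof (intro sum_mono)
        fix i assume "i \<in> S"
        then have "\<bar>a j i\<bar> \<le> 1" using a that less.prems(1) by auto
        then have "\<bar>a j i\<bar> * \<bar>a j i\<bar> \<le> 1 * \<bar>a j i\<bar>" by (intro mult_right_mono) auto
        then show "(a j i)\<^sup>2 \<le> \<bar>a j i\<bar>" by (simp add: power2_eq_square)
      qed
      then show ?thesis using that by (auto simp: B_def)
    qed
    have "100 * card B < card S"
      unfolding B_def r_def using less.prems S8 by (intro good) auto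
    then have "\<exists>x. (\<forall>i\<in>S. \<bar>x i\<bar> \<le> 1) \<and> (\<forall>i. i \<notin> S \<longrightarrow> x i = x0 i) \<and>
      2 * card {i\<in>S. \<bar>x i\<bar> \<noteq> 1} \<le> card S \<and>
      (\<forall>j\<in>B. (\<Sum>i\<in>S. a j i * (x i - x0 i)) = 0) \<and>
      (\<forall>j\<in>{..<m}-B. \<bar>\<Sum>i\<in>S. a j i * (x i - x0 i)\<bar> \<le> 9 * sqrt (r * ln (400 * real m / card S)))"
      using fin less.prems S8 \<open>r > 0\<close> sq by (intro partial_coloring) (auto simp: B_def)
    then obtain y where y: "\<And>i. i \<in> S \<Longrightarrow> \<bar>y i\<bar> \<le> 1" "\<And>i. i \<notin> S \<Longrightarrow> y i = x0 i"
      "2 * card {i\<in>S. \<bar>y i\<bar> \<noteq> 1} \<le> card S"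
      and yB: "\<And>j. j \<in> B \<Longrightarrow> (\<Sum>i\<in>S. a j i * (y i - x0 i)) = 0"
      "\<And>j. j \<in> {..<m} - B \<Longrightarrow> \<bar>\<Sum>i\<in>S. a j i * (y i - x0 i)\<bar> \<le> \<beta>"
      unfolding \<beta>_def by blast
    have "400 * real m / card S \<ge> 1" using less.prems(2) S8 by (simp add: field_simps)
    then have "\<beta> \<ge> 0" using \<open>r > 0\<close> by (simp add: \<beta>_def)
    then have y_disc: "\<bar>\<Sum>i\<in>S. a j i * (y i - x0 i)\<bar> \<le> \<beta>" if "j < m" for j
      using yB that by (cases "j \<in> B") auto
    define T where "T = {i\<in>S. \<bar>y i\<bar> \<noteq> 1}"
    have T: "T \<subseteq> S" "2 * card T \<le> card S" using y(3) by (auto simp: T_def)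
    then have "card T < card S" using S8 by simp
    then have "\<exists>x. (\<forall>i\<in>T. \<bar>x i\<bar> = 1) \<and> (\<forall>i. i \<notin> T \<longrightarrow> x i = y i) \<and>
      (\<forall>j<m. \<bar>\<Sum>i\<in>T. a j i * (x i - y i)\<bar>
        \<le> halving_const * sqrt t * (card T / m) powr (1/8) + 1018 * sqrt t)"
      using T less.prems y(1) by (intro less.hyps) auto
    then obtain x where x: "\<And>i. i \<in> T \<Longrightarrow> \<bar>x i\<bar> = 1" "\<And>i. i \<notin> T \<Longrightarrow> x i = y i"
      "\<And>j. j < m \<Longrightarrow> \<bar>\<Sum>i\<in>T. a j i * (x i - y i)\<bar>
        \<le> halving_const * sqrt t * (card T / m) powr (1/8) + 1018 * sqrt t" by blast
    have "\<bar>\<Sum>i\<in>S. a j i * (x i - x0 i)\<bar>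
      \<le> halving_const * sqrt t * (card S / m) powr (1/8) + 1018 * sqrt t" if "j < m" for j
    proof -
      have "(\<Sum>i\<in>S. a j i * (x i - x0 i)) = (\<Sum>i\<in>S. a j i * (x i - y i)) + (\<Sum>i\<in>S. a j i * (y i - x0 i))"
        by (simp add: algebra_simps flip: sum.distrib)
      also have "(\<Sum>i\<in>S. a j i * (x i - y i)) = (\<Sum>i\<in>T. a j i * (x i - y i))"
        using T x(2) fin by (intro sum.mono_neutral_right) auto
      finally have "\<bar>\<Sum>i\<in>S. a j i * (x i - x0 i)\<bar>
          \<le> halving_const * sqrt t * (card T / m) powr (1/8) + 1018 * sqrt t + \<beta>"
        using x(3)[OF that] y_disc[OF that] by linarith
      moreover have "\<beta> \<le> 9 * sqrt 5090 * sqrt t * (card S / m) powr (1/8)"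
        unfolding \<beta>_def r_def using less.prems(2) S8 St assms(2)
        by (intro partial_coloring_bound_le) auto
      moreover have "(card T / m) powr (1/8) \<le> (1/2) powr (1/8) * (card S / m) powr (1/8)"
      proof -
        have "real (card T) / m \<le> 1/2 * (real (card S) / m)"
          using T(2) assms(1) by (simp add: field_simps)
        then have "(card T / m) powr (1/8) \<le> (1/2 * (real (card S) / m)) powr (1/8)"
          by (intro powr_mono2) auto
        then show ?thesis by (simp only: powr_mult)
      qed
      then have "halving_const * sqrt t * (card T / m) powr (1/8)
          \<le> halving_const * sqrt t * ((1/2) powr (1/8) * (card S / m) powr (1/8))"
        using halving_const(1) by (intro mult_left_mono) auto
      \<comment> \<open>The loss of this stage plus the contracted loss of the remaining ones is
        \<open>halving_const\<close> again, by its fixed-point equation.\<close>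
      moreover have "9 * sqrt 5090 * sqrt t * (card S / m) powr (1/8)
          + halving_const * sqrt t * ((1/2) powr (1/8) * (card S / m) powr (1/8))
          = (9 * sqrt 5090 + halving_const * (1/2) powr (1/8)) * (sqrt t * (card S / m) powr (1/8))"
        by (simp only: algebra_simps)
      ultimately show ?thesis
        unfolding halving_const(2) by (simp only: mult.assoc)
    qed
    moreover have "\<bar>x i\<bar> = 1" if "i \<in> S" for i
      using that x(1,2) by (cases "i \<in> T") (auto simp: T_def)
    moreover have "x i = x0 i" if "i \<notin> S" for i
      using that x(2) y(2) T(1) by (metis subsetD)
    ultimately show ?thesis by blast
  qed
qed

lemma full_coloring:
  fixes a :: "nat \<Rightarrow> 'i \<Rightarrow> real" and m t :: nat
  assumes "0 < m" "0 < t" and a: "\<And>j i. j < m \<Longrightarrow> i \<in> X \<Longrightarrow> \<bar>a j i\<bar> \<le> 1"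
    and good: "\<And>S. S \<subseteq> X \<Longrightarrow> S \<noteq> {} \<Longrightarrow> card S \<le> m \<Longrightarrow>
      100 * card {j\<in>{..<m}. 9 * real (card S) * real t / real m + 500 * sqrt t \<le> (\<Sum>i\<in>S. \<bar>a j i\<bar>)} < card S"
    and X: "finite X" "\<And>i. i \<in> X \<Longrightarrow> \<bar>x0 i\<bar> \<le> 1"
  shows "\<exists>x. (\<forall>i\<in>X. \<bar>x i\<bar> = 1) \<and>
    (\<forall>j<m. \<bar>\<Sum>i\<in>X. a j i * (x i - x0 i)\<bar> \<le> (halving_const + 1018) * sqrt t)"
proof -
  \<comment> \<open>With weight threshold 0, every nonzero row counts as heavy; there are only
    \<open>m\<close> of them, so more than \<open>m\<close> columns always leave a direction that
    changes no row sum.\<close>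
  have "card {j\<in>{..<m}. 0 < (\<Sum>i\<in>T. \<bar>a j i\<bar>)} < card T" if "m < card T" for T
  proof -
    have "card {j\<in>{..<m}. 0 < (\<Sum>i\<in>T. \<bar>a j i\<bar>)} \<le> card {..<m}"
      by (intro card_mono) auto
    then show ?thesis using that by simp
  qed
  then have "\<exists>x. (\<forall>i\<in>X. \<bar>x i\<bar> \<le> 1) \<and> (\<forall>i. i \<notin> X \<longrightarrow> x i = x0 i) \<and> card {i\<in>X. \<bar>x i\<bar> \<noteq> 1} \<le> m \<and>
    (\<forall>j\<in>{..<m}. \<bar>\<Sum>i\<in>X. a j i * (x i - x0 i)\<bar> \<le> 2 * 0)"
    using X by (intro beck_fiala_rounding) auto
  then obtain y where y: "\<And>i. i \<in> X \<Longrightarrow> \<bar>y i\<bar> \<le> 1" "card {i\<in>X. \<bar>y i\<bar> \<noteq> 1} \<le> m"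
    "\<And>j. j < m \<Longrightarrow> (\<Sum>i\<in>X. a j i * (y i - x0 i)) = 0" by auto
  define S where "S = {i\<in>X. \<bar>y i\<bar> \<noteq> 1}"
  have S: "S \<subseteq> X" "card S \<le> m" using y(2) by (auto simp: S_def)
  have "\<exists>x. (\<forall>i\<in>S. \<bar>x i\<bar> = 1) \<and> (\<forall>i. i \<notin> S \<longrightarrow> x i = y i) \<and>
    (\<forall>j<m. \<bar>\<Sum>i\<in>S. a j i * (x i - y i)\<bar>
      \<le> halving_const * sqrt t * (card S / m) powr (1/8) + 1018 * sqrt t)"
    by (rule full_coloring_few_columns[OF assms(1,2) a good X(1) S]) (use y(1) S in auto)
  then obtain x where x: "\<And>i. i \<in> S \<Longrightarrow> \<bar>x i\<bar> = 1" "\<And>i. i \<notin> S \<Longrightarrow> x i = y i"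
    "\<And>j. j < m \<Longrightarrow> \<bar>\<Sum>i\<in>S. a j i * (x i - y i)\<bar>
      \<le> halving_const * sqrt t * (card S / m) powr (1/8) + 1018 * sqrt t" by blast
  have "\<bar>\<Sum>i\<in>X. a j i * (x i - x0 i)\<bar> \<le> (halving_const + 1018) * sqrt t" if "j < m" for j
  proof -
    have "(\<Sum>i\<in>X. a j i * (x i - x0 i)) = (\<Sum>i\<in>X. a j i * (x i - y i)) + (\<Sum>i\<in>X. a j i * (y i - x0 i))"
      by (simp add: algebra_simps flip: sum.distrib)
    also have "(\<Sum>i\<in>X. a j i * (x i - y i)) = (\<Sum>i\<in>S. a j i * (x i - y i))"
      using S x(2) X(1) by (intro sum.mono_neutral_right) auto
    finally have "\<bar>\<Sum>i\<in>X. a j i * (x i - x0 i)\<bar>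
        \<le> halving_const * sqrt t * (card S / m) powr (1/8) + 1018 * sqrt t"
      using x(3)[OF that] y(3)[OF that] by linarith
    also have "halving_const * sqrt t * (card S / m) powr (1/8) \<le> halving_const * sqrt t * 1"
      using halving_const(1) S(2) assms(1) by (intro mult_left_mono powr_le1) auto
    finally show ?thesis by (simp add: algebra_simps)
  qed
  moreover have "\<bar>x i\<bar> = 1" if "i \<in> X" for i
    using that x(1,2) by (cases "i \<in> S") (auto simp: S_def)
  ultimately show ?thesis by blast
qed

section \<open>Random sparse matrices\<close>

text \<open>The quotient of the two binomials is a product of \<open>u\<close> factors (t - i)/(m -
  i), and each of them is at most t/m because t is at most m.\<close>

lemma binomial_ratio_le:
  assumes "u \<le> t" "t \<le> m" "0 < m"
  shows "real ((m - u) choose (t - u)) \<le> (real t / real m) ^ u * real (m choose t)"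
  using assms(1)
proof (induction u)
  case 0
  then show ?case by simp
next
  case (Suc u)
  define n k where "n = m - Suc u" and "k = t - Suc u"
  have nk: "m - u = Suc n" "t - u = Suc k"
    using Suc.prems assms by (auto simp: n_def k_def)
  have "real (Suc k) * real (Suc n choose Suc k) = real (Suc n) * real (n choose k)"
    using binomial_absorption[of k n] by (metis diff_Suc_1 of_nat_mult Suc_times_binomial)
  then have "real (n choose k) = real (Suc k) / real (Suc n) * real (Suc n choose Suc k)"
    by (simp add: field_simps del: of_nat_Suc)
  moreover have "real (Suc k) / real (Suc n) \<le> real t / real m"
  proof -
    have eqs: "real (Suc k) = real t - real u" "real (Suc n) = real m - real u"
      using nk Suc.prems assms by linarith+
    have "real u * real t \<le> real u * real m"
      using assms by (intro mult_left_mono) auto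
    then have "(real t - real u) * real m \<le> real t * (real m - real u)"
      by (simp add: algebra_simps)
    moreover have "real m - real u > 0" using assms Suc.prems by simp
    ultimately show ?thesis
      unfolding eqs using assms(3) by (subst frac_le_eq) (auto simp: divide_le_0_iff algebra_simps)
  qed
  moreover have "real (Suc n choose Suc k) \<le> (real t / real m) ^ u * real (m choose t)"
    using Suc.IH Suc.prems nk by simp
  ultimately have "real (n choose k) \<le> real t / real m * ((real t / real m) ^ u * real (m choose t))"
    by (simp only:) (intro mult_mono, auto)
  then show ?case
    by (simp only: n_def k_def power_Suc mult.assoc)
qed

text \<open>Identify a vector with its support and remove \<open>U\<close> from it. The case
  distinction is essential: for \<open>card U > t\<close> truncated subtraction would turn the
  binomial coefficient into 1 instead of 0.\<close>

lemma card_sparse_vecs_containing: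
  assumes "U \<subseteq> {..<m}"
  shows "card {v \<in> sparse_vecs m t. \<forall>j\<in>U. v $ j = 1} =
    (if card U \<le> t then (m - card U) choose (t - card U) else 0)"
proof -
  have U: "finite U" using assms finite_subset by blast
  define \<T> where "\<T> = {T. T \<subseteq> {..<m} \<and> card T = t \<and> U \<subseteq> T}"
  have "bij_betw (\<lambda>T. vec m (indicator T)) \<T> {v \<in> sparse_vecs m t. \<forall>j\<in>U. v $ j = 1}"
  proof (rule bij_betwI[where g = "\<lambda>v. {i. i < m \<and> v $ i = 1}"])
    show "(\<lambda>T. vec m (indicator T)) \<in> \<T> \<rightarrow> {v \<in> sparse_vecs m t. \<forall>j\<in>U. v $ j = 1}"
    proof (rule Pi_I)
      fix T assume T: "T \<in> \<T>"
      then have "{i. i < m \<and> vec m (indicator T) $ i = (1::real)} = T"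
        by (auto simp: \<T>_def indicator_def split: if_splits)
      then show "vec m (indicator T) \<in> {v \<in> sparse_vecs m t. \<forall>j\<in>U. v $ j = 1}"
        using T by (auto simp: sparse_vecs_def \<T>_def indicator_def subset_iff)
    qed
    show "(\<lambda>v. {i. i < m \<and> v $ i = 1}) \<in> {v \<in> sparse_vecs m t. \<forall>j\<in>U. v $ j = 1} \<rightarrow> \<T>"
      using assms by (auto simp: sparse_vecs_def \<T>_def)
    show "{i. i < m \<and> vec m (indicator T) $ i = (1::real)} = T" if "T \<in> \<T>" for T
      using that by (auto simp: \<T>_def indicator_def split: if_splits)
    show "vec m (indicator {i. i < m \<and> v $ i = 1}) = v"
      if "v \<in> {v \<in> sparse_vecs m t. \<forall>j\<in>U. v $ j = 1}" for v
      using that by (intro eq_vecI) (auto simp: sparse_vecs_def indicator_def)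
  qed
  then have "card {v \<in> sparse_vecs m t. \<forall>j\<in>U. v $ j = 1} = card \<T>"
    by (simp add: bij_betw_same_card)
  also have "card \<T> = (if card U \<le> t then (m - card U) choose (t - card U) else 0)"
  proof (cases "card U \<le> t")
    case True
    have "bij_betw (\<lambda>T. T - U) \<T> {W. W \<subseteq> {..<m} - U \<and> card W = t - card U}"
    proof (rule bij_betwI[where g = "\<lambda>W. W \<union> U"])
      show "(\<lambda>T. T - U) \<in> \<T> \<rightarrow> {W. W \<subseteq> {..<m} - U \<and> card W = t - card U}"
        using U by (auto simp: \<T>_def card_Diff_subset)
      show "(\<lambda>W. W \<union> U) \<in> {W. W \<subseteq> {..<m} - U \<and> card W = t - card U} \<rightarrow> \<T>"
      proof (rule Pi_I)
        fix W assume W: "W \<in> {W. W \<subseteq> {..<m} - U \<and> card W = t - card U}"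
        then have "finite W" using finite_subset by blast
        then have "card (W \<union> U) = card W + card U"
          using W U by (intro card_Un_disjoint) auto
        then show "W \<union> U \<in> \<T>" using W True assms by (auto simp: \<T>_def)
      qed
    qed (auto simp: \<T>_def)
    then have "card \<T> = card {W. W \<subseteq> {..<m} - U \<and> card W = t - card U}"
      by (rule bij_betw_same_card)
    also have "\<dots> = card ({..<m} - U) choose (t - card U)"
      by (intro n_subsets) auto
    also have "card ({..<m} - U) = m - card U"
      using assms U by (simp add: card_Diff_subset)
    finally show ?thesis using True by simp
  next
    case False
    have "\<T> = {}"
    proof safe
      fix T assume "T \<in> \<T>"
      then have "card U \<le> card T" "card T = t"
        by (auto simp: \<T>_def intro: card_mono finite_subset)
      then show "T \<in> {}" using False by simp
    qed
    then show ?thesis using False by simp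
  qed
  finally show ?thesis .
qed

lemma prob_sparse_vec_containing:
  assumes "U \<subseteq> {..<m}" "t \<le> m" "0 < m"
  shows "measure_pmf.prob (pmf_of_set (sparse_vecs m t)) {v. \<forall>j\<in>U. v $ j = 1} \<le> (real t / real m) ^ card U"
proof -
  have "card (sparse_vecs m t) = m choose t"
    using card_sparse_vecs_containing[of "{}" m t] by simp
  moreover have "m choose t > 0" using assms by simp
  moreover have eq: "sparse_vecs m t \<inter> {v. \<forall>j\<in>U. v $ j = 1} = {v \<in> sparse_vecs m t. \<forall>j\<in>U. v $ j = 1}"
    by auto
  ultimately have "measure_pmf.prob (pmf_of_set (sparse_vecs m t)) {v. \<forall>j\<in>U. v $ j = 1}
      = card {v \<in> sparse_vecs m t. \<forall>j\<in>U. v $ j = 1} / (m choose t)"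
    by (simp add: measure_pmf_of_set[OF sparse_vecs_nonempty[OF assms(2)] finite_sparse_vecs] eq)
  also have "\<dots> \<le> (real t / real m) ^ card U"
    using binomial_ratio_le[of "card U" t m] assms \<open>m choose t > 0\<close>
    by (simp add: card_sparse_vecs_containing[OF assms(1)] divide_le_eq)
  finally show ?thesis .
qed

text \<open>Within a column, sampling without replacement makes prescribed ones at most as likely as
  independent entries of mean t/m; across columns, independence gives a product. So a prescribed set
  of ones is bounded as for independent entries.\<close>

lemma prob_entries_one_le:
  assumes P: "random_sparse_matrix m k t P" and E: "E \<subseteq> {..<m} \<times> {..<k}" and "t \<le> m" "0 < m" "0 < k"
  shows "measure_pmf.prob P {A. \<forall>e\<in>E. A $$ e = 1} \<le> (real t / real m) ^ card E"
proof -
  define U where "U = (\<lambda>i. {j. (j, i) \<in> E})"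
  have U: "U i \<subseteq> {..<m}" for i using E by (auto simp: U_def)
  have "measure_pmf.prob P {A. \<forall>e\<in>E. A $$ e = 1}
      \<le> measure_pmf.prob P (\<Inter>i<k. (\<lambda>A. col A i) -` {v. \<forall>j\<in>U i. v $ j = 1})"
  proof (rule measure_pmf.finite_measure_mono_AE[OF AE_pmfI])
    fix A assume "A \<in> set_pmf P"
    then have "A \<in> carrier_mat m k" using P by (auto simp: random_sparse_matrix_def)
    then show "A \<in> {A. \<forall>e\<in>E. A $$ e = 1} \<longrightarrow>
        A \<in> (\<Inter>i<k. (\<lambda>A. col A i) -` {v. \<forall>j\<in>U i. v $ j = 1})"
      using E by (auto simp: U_def)
  qed simp
  also have "\<dots> = (\<Prod>i<k. measure_pmf.prob P ((\<lambda>A. col A i) -` {v. \<forall>j\<in>U i. v $ j = 1}))"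
    using prob_space.indep_varsD[OF measure_pmf.prob_space_axioms, where J = "{..<k}" and A = "\<lambda>i. {v. \<forall>j\<in>U i. v $ j = 1}"] P assms(5)
    by (fastforce simp: random_sparse_matrix_def)
  also have "\<dots> \<le> (\<Prod>i<k. (real t / real m) ^ card (U i))"
  proof (intro prod_mono conjI)
    fix i assume "i \<in> {..<k}"
    then have "pmf_of_set (sparse_vecs m t) = map_pmf (\<lambda>A. col A i) P"
      using P by (simp add: random_sparse_matrix_def)
    then have "measure_pmf.prob P ((\<lambda>A. col A i) -` {v. \<forall>j\<in>U i. v $ j = 1})
        = measure_pmf.prob (pmf_of_set (sparse_vecs m t)) {v. \<forall>j\<in>U i. v $ j = 1}"
      by simp
    then show "measure_pmf.prob P ((\<lambda>A. col A i) -` {v. \<forall>j\<in>U i. v $ j = 1}) \<le> (real t / real m) ^ card (U i)"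
      using prob_sparse_vec_containing[OF U assms(3,4)] by simp
  qed simp
  also have "\<dots> = (real t / real m) ^ (\<Sum>i<k. card (U i))"
    by (rule power_sum[symmetric])
  also have "(\<Sum>i<k. card (U i)) = card (Sigma {..<k} U)"
    using U finite_subset by (subst card_SigmaI) blast+
  \<comment> \<open>Grouping by columns lists the entries as (column, row), whereas \<open>E\<close>
    holds (row, column).\<close>
  also have "Sigma {..<k} U = prod.swap ` E"
    using E by (force simp: U_def image_iff)
  also have "card \<dots> = card E"
    by (intro card_image) auto
  finally show ?thesis .
qed

section \<open>Union bound over dense submatrices\<close>

text \<open>Here q^q/q! is a single term of the exponential series for exp(q), which bounds q! from
  below by (q/e)^q.\<close>

lemma binomial_le_exp_power:
  assumes "0 < q"
  shows "real (n choose q) \<le> (exp 1 * real n / real q) ^ q"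
proof -
  have "real q ^ q /\<^sub>R fact q \<le> exp (real q)"
    unfolding exp_def using sum_le_suminf[OF summable_exp_generic, of "{q}" "real q"] by simp
  then have 1: "real q ^ q \<le> exp 1 ^ q * fact q"
    by (simp add: field_simps exp_of_nat_mult[symmetric])
  have "real (n choose q) * fact q \<le> real n ^ q"
    using binomial_fact_pow[of n q] by (metis of_nat_fact of_nat_le_iff of_nat_mult of_nat_power)
  then have "real q ^ q * (real (n choose q) * fact q) \<le> (exp 1 ^ q * fact q) * real n ^ q"
    using 1 by (intro mult_mono) auto
  then have "fact q * (real (n choose q) * real q ^ q) \<le> fact q * (exp 1 ^ q * real n ^ q)"
    by (simp add: mult_ac)
  then have "real (n choose q) * real q ^ q \<le> exp 1 ^ q * real n ^ q"
    by simp
  then show ?thesis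
    using assms by (simp add: power_divide power_mult_distrib le_divide_eq)
qed

text \<open>A submatrix with at least \<open>q\<close> ones contains a set of exactly
  \<open>q\<close> of them. The union bound therefore runs over triples of columns, rows and
  positions, and each triple prescribes \<open>q\<close> entries.\<close>

lemma prob_dense_submatrix_le:
  assumes P: "random_sparse_matrix m k t P" and "t \<le> m" "0 < m" "0 < k"
  shows "measure_pmf.prob P {A. \<exists>S J. S \<subseteq> {..<k} \<and> card S = s \<and> J \<subseteq> {..<m} \<and> card J = l \<and>
      q \<le> card {e \<in> J \<times> S. A $$ e = 1}}
    \<le> real (k choose s) * real (m choose l) * real (l * s choose q) * (real t / real m) ^ q"
proof -
  define \<S> where "\<S> = {S. S \<subseteq> {..<k} \<and> card S = s}"
  define \<J> where "\<J> = {J. J \<subseteq> {..<m} \<and> card J = l}"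
  define \<E> where "\<E> = (\<lambda>(S :: nat set) (J :: nat set). {E. E \<subseteq> J \<times> S \<and> card E = q})"
  define I where "I = (SIGMA S:\<S>. SIGMA J:\<J>. \<E> S J)"
  have fin: "finite \<S>" "finite \<J>" by (auto simp: \<S>_def \<J>_def)
  have finS: "finite S" if "S \<in> \<S>" for S using that finite_subset by (auto simp: \<S>_def)
  have finJ: "finite J" if "J \<in> \<J>" for J using that finite_subset by (auto simp: \<J>_def)
  have finE: "finite (\<E> S J)" if "S \<in> \<S>" "J \<in> \<J>" for S J
    using finS finJ that by (auto simp: \<E>_def)
  have "card (\<E> S J) = l * s choose q" if "S \<in> \<S>" "J \<in> \<J>" for S J
  proof -
    have "card (\<E> S J) = card (J \<times> S) choose q"
      unfolding \<E>_def using that finS finJ by (intro n_subsets) auto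
    then show ?thesis using that by (simp add: \<S>_def \<J>_def card_cartesian_product)
  qed
  then have "card I = card \<S> * (card \<J> * (l * s choose q))"
    unfolding I_def using fin finE by simp
  then have card_I: "card I = (k choose s) * (m choose l) * (l * s choose q)"
    by (simp add: \<S>_def \<J>_def n_subsets)
  have finI: "finite I" unfolding I_def using fin finE by auto
  have "{A :: real mat. \<exists>S J. S \<subseteq> {..<k} \<and> card S = s \<and> J \<subseteq> {..<m} \<and> card J = l \<and> q \<le> card {e \<in> J \<times> S. A $$ e = 1}}
      \<subseteq> (\<Union>(S, J, E)\<in>I. {A. \<forall>e\<in>E. A $$ e = 1})"
  proof (rule subsetI)
    fix A :: "real mat"
    assume "A \<in> {A. \<exists>S J. S \<subseteq> {..<k} \<and> card S = s \<and> J \<subseteq> {..<m} \<and> card J = l \<and> q \<le> card {e \<in> J \<times> S. A $$ e = 1}}"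
    then obtain S J where *: "S \<subseteq> {..<k}" "card S = s" "J \<subseteq> {..<m}" "card J = l"
      "q \<le> card {e \<in> J \<times> S. A $$ e = 1}" by blast
    obtain E where E: "E \<subseteq> {e \<in> J \<times> S. A $$ e = 1}" "card E = q"
      using obtain_subset_with_card_n[OF *(5)] by metis
    then have "(S, J, E) \<in> I" using * by (auto simp: I_def \<S>_def \<J>_def \<E>_def)
    then show "A \<in> (\<Union>(S, J, E)\<in>I. {A. \<forall>e\<in>E. A $$ e = 1})"
      using E(1) by (intro UN_I[of "(S, J, E)"]) auto
  qed
  then have "measure_pmf.prob P {A. \<exists>S J. S \<subseteq> {..<k} \<and> card S = s \<and> J \<subseteq> {..<m} \<and> card J = l \<and>
      q \<le> card {e \<in> J \<times> S. A $$ e = 1}} \<le> measure_pmf.prob P (\<Union>(S, J, E)\<in>I. {A. \<forall>e\<in>E. A $$ e = 1})"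
    by (intro measure_pmf.finite_measure_mono) auto
  also have "\<dots> \<le> (\<Sum>(S, J, E)\<in>I. measure_pmf.prob P {A. \<forall>e\<in>E. A $$ e = 1})"
    using measure_pmf.finite_measure_subadditive_finite[OF finI,
        of "\<lambda>(S, J, E). {A. \<forall>e\<in>E. A $$ e = 1}" P]
    by (simp add: case_prod_unfold)
  also have "\<dots> \<le> (\<Sum>x\<in>I. (real t / real m) ^ q)"
  proof (intro sum_mono)
    fix x assume "x \<in> I"
    moreover obtain S J E where x: "x = (S, J, E)" by (cases x) auto
    ultimately have "E \<subseteq> {..<m} \<times> {..<k}" "card E = q"
      by (auto simp: I_def \<S>_def \<J>_def \<E>_def)
    then show "(case x of (S, J, E) \<Rightarrow> measure_pmf.prob P {A. \<forall>e\<in>E. A $$ e = 1}) \<le> (real t / real m) ^ q"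
      using prob_entries_one_le[OF P _ assms(2-4), of E] x by simp
  qed
  also have "\<dots> = real (k choose s) * real (m choose l) * real (l * s choose q) * (real t / real m) ^ q"
    by (simp add: card_I)
  finally show ?thesis .
qed

text \<open>All costs are counted per heavy row, with T = \<open>sqrt t\<close> and w = ln(m/s). As
  s is at most 100 l, choosing the columns costs at most 100 (T + w) per row, choosing the rows
  costs 8 + w, and the prescribed ones gain r u. Half of r is kept in reserve for the final
  exponent.\<close>

lemma union_bound_estimate:
  fixes m k t s l q :: nat and r :: real
  assumes "0 < m" "0 < k" "0 < t" "t \<le> m" "0 < s" "s \<le> m"
    and L: "(ln (exp 1 * real k / real m))\<^sup>2 \<le> real t"
    and r: "r = 9 * real s * real t / real m + 500 * sqrt (real t)" "r \<le> real s"
    and l: "l = (s + 99) div 100" and q: "real l * r \<le> real q"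
  shows "real (k choose s) * real (m choose l) * real (l * s choose q) * (real t / real m) ^ q
    \<le> exp (- real t - real s)"
proof -
  define T where "T = sqrt (real t)"
  define w where "w = ln (real m / real s)"
  define u where "u = ln (r * real m / (exp 1 * real s * real t))"
  have T: "T \<ge> 1" "T\<^sup>2 = real t" using assms(3) by (auto simp: T_def)
  have w: "w \<ge> 0" using assms by (auto simp: w_def)
  have r_ge: "r \<ge> 500 * T" "r \<ge> 9 * real s * real t / real m"
    using T by (auto simp: r(1) T_def)
  have r_pos: "r > 0" using r_ge T by linarith
  have "100 * l \<ge> s" "l \<le> s" "l > 0" using assms(5) unfolding l by auto
  then have l_ge: "100 * real l \<ge> real s" and l_pos: "real l > 0" by linarith+
  have q_pos: "real q > 0" using q mult_pos_pos[OF l_pos r_pos] by linarith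
  have e2: "exp 1 * exp 1 \<le> (9::real)"
    using mult_mono[OF exp_le exp_le] by simp

  have L_le: "ln (exp 1 * real k / real m) \<le> T"
    unfolding T_def using L by (rule real_le_rsqrt)
  have "real (k choose s) \<le> (exp 1 * real k / real s) ^ s"
    using assms(5) by (rule binomial_le_exp_power)
  also have "\<dots> = exp (real s * ln (exp 1 * real k / real s))"
    using assms by (simp add: exp_of_nat_mult)
  \<comment> \<open>Comparing with k/m isolates the logarithm that the hypothesis on t bounds by T;
    the remainder w is the price of small column sets.\<close>
  also have "ln (exp 1 * real k / real s) = ln (exp 1 * real k / real m) + w"
    using assms by (simp add: w_def ln_div ln_mult)
  also have "exp (real s * (ln (exp 1 * real k / real m) + w)) \<le> exp (100 * real l * (T + w))"
  proof -
    have "real s * (ln (exp 1 * real k / real m) + w) \<le> real s * (T + w)"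
      using L_le by (intro mult_left_mono) auto
    also have "\<dots> \<le> 100 * real l * (T + w)"
      using l_ge T w by (intro mult_right_mono) auto
    finally show ?thesis by simp
  qed
  finally have b1: "real (k choose s) \<le> exp (100 * real l * (T + w))" .

  have "real (m choose l) \<le> (exp 1 * real m / real l) ^ l"
    using \<open>l > 0\<close> by (rule binomial_le_exp_power)
  also have "\<dots> \<le> (exp 1 * (100 * (real m / real s))) ^ l"
  proof (intro power_mono)
    have "real m * real s \<le> real m * (100 * real l)"
      using l_ge by (intro mult_left_mono) auto
    then show "exp 1 * real m / real l \<le> exp 1 * (100 * (real m / real s))"
      using assms l_pos by (simp add: field_simps)
  qed simp
  also have "\<dots> = exp (real l * ln (exp 1 * (100 * (real m / real s))))"
    using assms by (simp add: exp_of_nat_mult)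
  also have "\<dots> \<le> exp (real l * (8 + w))"
  proof -
    have "ln (100::real) \<le> ln (2 ^ 7)" by (subst ln_le_cancel_iff) auto
    also have "\<dots> = 7 * ln 2" by (subst ln_realpow) auto
    also have "\<dots> \<le> 7" using ln_2_less_1 by simp
    finally have "ln (100::real) \<le> 7" .
    moreover have "ln (exp 1 * (100 * g)) = 1 + ln 100 + ln g" if "g > 0" for g :: real
      using that by (simp add: ln_mult)
    then have "ln (exp 1 * (100 * (real m / real s))) = 1 + ln 100 + w"
      unfolding w_def by this (use assms in simp)
    ultimately have "ln (exp 1 * (100 * (real m / real s))) \<le> 8 + w" by linarith
    then show ?thesis using l_pos by simp
  qed
  finally have b2: "real (m choose l) \<le> exp (real l * (8 + w))" .

  \<comment> \<open>This is the origin of the 9 in the heaviness threshold: 9 is at least e^2, one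
    factor e for the binomial estimate and one to leave u at least 1.\<close>
  have u_ge1: "u \<ge> 1"
  proof -
    have "exp 1 * (exp 1 * real s * real t) \<le> 9 * real s * real t"
      using mult_right_mono[OF e2, of "real s * real t"] by (simp add: mult_ac)
    also have "\<dots> \<le> r * real m"
      using r_ge(2) assms(1) by (simp add: divide_le_eq)
    finally have "exp 1 \<le> r * real m / (exp 1 * real s * real t)"
      using assms by (simp add: le_divide_eq)
    then show ?thesis
      unfolding u_def by (metis exp_gt_zero ln_exp ln_mono order_less_le_trans)
  qed

  have "real (l * s choose q) * (real t / real m) ^ q
      \<le> (exp 1 * real (l * s) / real q) ^ q * (real t / real m) ^ q"
    using q_pos by (intro mult_right_mono binomial_le_exp_power) auto
  also have "\<dots> = (exp 1 * real l * real s * real t / (real q * real m)) ^ q"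
    by (simp add: power_mult_distrib[symmetric] mult_ac)
  also have "\<dots> \<le> (exp 1 * real s * real t / (r * real m)) ^ q"
  proof (intro power_mono)
    have "real l * (r * (exp 1 * real s * real t * real m)) \<le> real q * (exp 1 * real s * real t * real m)"
      using mult_right_mono[OF q, of "exp 1 * real s * real t * real m"] by (simp add: mult_ac)
    then show "exp 1 * real l * real s * real t / (real q * real m) \<le> exp 1 * real s * real t / (r * real m)"
      using q_pos r_pos assms by (simp add: divide_simps mult_ac)
  qed (use q_pos in auto)
  also have "exp 1 * real s * real t / (r * real m) = exp (- u)"
    using r_pos assms by (simp add: u_def exp_minus)
  also have "exp (- u) ^ q = exp (- (real q * u))"
    by (simp flip: exp_of_nat_mult)
  also have "\<dots> \<le> exp (- (real l * r * u))"
    using mult_right_mono[OF q, of u] u_ge1 by simp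
  finally have b3: "real (l * s choose q) * (real t / real m) ^ q \<le> exp (- (real l * r * u))" .

  \<comment> \<open>If w is at most T, then u at least 1 suffices, as r/2 is at least 250 T. For w
    larger than T, the part 500 T of r gives u at least 1 - ln T + w, hence at least 1 + w/2, and
    the gain r w/2 covers the multiples of w.\<close>
  have ru: "r * u \<ge> r / 2 + (100 * T + 101 * w + 8)"
  proof (cases "w \<le> T")
    case True
    have "r \<le> r * u" using mult_left_mono[OF u_ge1, of r] r_pos by simp
    then show ?thesis using r_ge(1) True T by linarith
  next
    case False
    have "ln T = 2 * ln (sqrt T)" using T by (simp add: ln_sqrt)
    also have "\<dots> \<le> 2 * (sqrt T - 1)" using T by (intro mult_left_mono ln_le_minus_one) auto
    also have "\<dots> \<le> T / 2"
      using zero_le_power2[of "sqrt T - 2"] T by (simp add: power2_diff)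
    finally have lnT: "ln T \<le> T / 2" .
    have "exp 1 / T * (real m / real s) * (exp 1 * real s * (T * T)) \<le> r * real m"
    proof -
      have "exp 1 / T * (real m / real s) * (exp 1 * real s * (T * T)) = (exp 1 * exp 1) * T * real m"
        using T assms(5) by (simp add: field_simps)
      also have "\<dots> \<le> 500 * T * real m"
        using e2 T by (intro mult_right_mono) auto
      also have "\<dots> \<le> r * real m" using r_ge(1) by (intro mult_right_mono) auto
      finally show ?thesis .
    qed
    then have "exp 1 / T * (real m / real s) \<le> r * real m / (exp 1 * real s * real t)"
      using T assms by (simp add: pos_le_divide_eq flip: power2_eq_square)
    then have "ln (exp 1 / T * (real m / real s)) \<le> u"
      unfolding u_def using T assms by (intro ln_mono) auto
    moreover have "ln (exp 1 / T * (real m / real s)) = 1 - ln T + w"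
      using T assms by (simp add: w_def ln_mult ln_div)
    ultimately have "u \<ge> w / 2 + 1" using lnT False by linarith
    then have "r * u \<ge> r * (w / 2 + 1)" using r_pos by (intro mult_left_mono) auto
    moreover have "r * w \<ge> 500 * w"
    proof (rule mult_right_mono)
      show "500 \<le> r" using r_ge(1) T by linarith
    qed (rule w)
    ultimately show ?thesis using r_ge(1) T w by (simp add: algebra_simps)
  qed
  \<comment> \<open>The reserve pays for -t because s is at least r: then s r is at least r^2, which
    is at least 250000 t. It pays for -s because r is at least 500; the term -s later makes the sum
    over all sizes converge.\<close>
  have "real t + real s \<le> real l * r / 2"
  proof -
    have "real s * 500 \<le> real s * r" using r_ge T by (intro mult_left_mono) linarith+
    moreover have "real t * 500 \<le> real s * r"
    proof -
      have "T * T * 250000 \<le> r * r" using mult_mono[OF r_ge(1) r_ge(1)] T r_pos by simp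
      also have "\<dots> \<le> real s * r" using r r_pos by (intro mult_right_mono) auto
      finally have "T * T * 250000 \<le> real s * r" .
      moreover have "T * T = real t" using T(2) by (simp add: power2_eq_square)
      ultimately show ?thesis by simp
    qed
    moreover have "real s * r \<le> 100 * (real l * r)"
      using mult_right_mono[OF l_ge, of r] r_pos by simp
    ultimately show ?thesis by linarith
  qed
  moreover have "real l * (r / 2 + (100 * T + 101 * w + 8)) \<le> real l * (r * u)"
    using ru l_pos by (intro mult_left_mono) auto
  ultimately have expo: "100 * real l * (T + w) + real l * (8 + w) + - (real l * r * u) \<le> - real t - real s"
    by (simp add: algebra_simps)
  have "real (k choose s) * real (m choose l) * (real (l * s choose q) * (real t / real m) ^ q)
      \<le> exp (100 * real l * (T + w)) * exp (real l * (8 + w)) * exp (- (real l * r * u))"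
    by (intro mult_mono b1 b2 b3) auto
  also have "\<dots> = exp (100 * real l * (T + w) + real l * (8 + w) + - (real l * r * u))"
    by (simp only: exp_add)
  also have "\<dots> \<le> exp (- real t - real s)" using expo by simp
  finally show ?thesis by (simp only: mult.assoc)
qed

lemma sum_exp_neg_le_1: "(\<Sum>s = 1..n. exp (- real s)) \<le> 1"
proof -
  have "(\<Sum>s = 1..n. exp (- real s)) \<le> 1 - (1/2) ^ n"
  proof (induction n)
    case (Suc n)
    have "exp (- real (Suc n)) = exp (- 1) ^ Suc n"
      by (simp only: exp_of_nat_mult[symmetric]) simp
    also have "\<dots> \<le> (1/2) ^ Suc n"
    proof (rule power_mono)
      have "exp 1 \<ge> (2::real)" using exp_ge_add_one_self[of 1] by simp
      then show "exp (- 1) \<le> (1/2::real)" by (simp add: exp_minus field_simps)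
    qed simp
    finally show ?case using Suc by simp
  qed simp
  also have "\<dots> \<le> 1" by simp
  finally show ?thesis .
qed

lemma random_sparse_matrix_entries:
  assumes P: "random_sparse_matrix m k t P" and "t \<le> m" "A \<in> set_pmf P" "j < m" "i < k"
  shows "A $$ (j, i) \<in> {0, 1}"
proof -
  have "set_pmf (map_pmf (\<lambda>A. col A i) P) = sparse_vecs m t"
    using P assms(5) set_pmf_of_set[OF sparse_vecs_nonempty[OF assms(2)] finite_sparse_vecs]
    by (simp add: random_sparse_matrix_def)
  then have "col A i \<in> sparse_vecs m t" using assms(3) by auto
  moreover have "A \<in> carrier_mat m k" using P assms(3) by (auto simp: random_sparse_matrix_def)
  ultimately show ?thesis using assms(4,5) by (auto simp: sparse_vecs_def)
qed

text \<open>Rows that are individually heavy for \<open>S\<close> are combined into a submatrix with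
  many ones, so that one union bound per size \<open>s\<close> suffices; the factors exp(-s) sum to
  at most 1 over the sizes.\<close>

lemma prob_heavy_rows_le:
  assumes P: "random_sparse_matrix m k t P"
    and "0 < m" "0 < k" "0 < t" "t \<le> m" "(ln (exp 1 * real k / real m))\<^sup>2 \<le> real t"
  shows "measure_pmf.prob P {A. \<exists>S. S \<subseteq> {..<k} \<and> S \<noteq> {} \<and> card S \<le> m \<and>
    card S \<le> 100 * card {j\<in>{..<m}. 9 * real (card S) * real t / real m + 500 * sqrt t \<le> (\<Sum>i\<in>S. \<bar>A $$ (j, i)\<bar>)}}
    \<le> exp (- real t)"
proof -
  define r where "r = (\<lambda>s::nat. 9 * real s * real t / real m + 500 * sqrt t)"
  define l where "l = (\<lambda>s::nat. (s + 99) div 100)"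
  \<comment> \<open>Rounding up loses nothing, since the number of ones in a submatrix is an
    integer; likewise \<open>l\<close> is s/100 rounded up, a number of heavy rows that every bad
    set of size s reaches.\<close>
  define q where "q = (\<lambda>s. nat \<lceil>real (l s) * r s\<rceil>)"
  define D where "D = (\<lambda>s. {A :: real mat. \<exists>S J. S \<subseteq> {..<k} \<and> card S = s \<and> J \<subseteq> {..<m} \<and> card J = l s \<and>
      q s \<le> card {e \<in> J \<times> S. A $$ e = 1}})"
  \<comment> \<open>Other sizes cannot be bad: on the support of \<open>P\<close> a row has at most
    \<open>s\<close> ones among \<open>s\<close> columns, so a heavy row forces
    \<open>r s \<le> real s\<close>. The probability estimate relies on this restriction.\<close>
  define I where "I = {s\<in>{1..m}. r s \<le> real s}"
  have I: "finite I" "I \<subseteq> {1..m}" by (auto simp: I_def)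
  have "measure_pmf.prob P {A. \<exists>S. S \<subseteq> {..<k} \<and> S \<noteq> {} \<and> card S \<le> m \<and>
      card S \<le> 100 * card {j\<in>{..<m}. r (card S) \<le> (\<Sum>i\<in>S. \<bar>A $$ (j, i)\<bar>)}}
    \<le> measure_pmf.prob P (\<Union>s\<in>I. D s)"
  proof (rule measure_pmf.finite_measure_mono_AE[OF AE_pmfI], rule impI)
    fix A assume A: "A \<in> set_pmf P"
      and "A \<in> {A. \<exists>S. S \<subseteq> {..<k} \<and> S \<noteq> {} \<and> card S \<le> m \<and>
      card S \<le> 100 * card {j\<in>{..<m}. r (card S) \<le> (\<Sum>i\<in>S. \<bar>A $$ (j, i)\<bar>)}}"
    then obtain S where S: "S \<subseteq> {..<k}" "S \<noteq> {}" "card S \<le> m"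
      "card S \<le> 100 * card {j\<in>{..<m}. r (card S) \<le> (\<Sum>i\<in>S. \<bar>A $$ (j, i)\<bar>)}" by auto
    have "finite S" using S(1) finite_subset by blast
    define s where "s = card S"
    have s: "s \<ge> 1" using S(2) \<open>finite S\<close> by (simp add: s_def Suc_le_eq card_gt_0_iff)
    have le: "l s \<le> card {j\<in>{..<m}. r s \<le> (\<Sum>i\<in>S. \<bar>A $$ (j, i)\<bar>)}"
      using S(4) unfolding l_def s_def by linarith
    obtain J where J: "J \<subseteq> {j\<in>{..<m}. r s \<le> (\<Sum>i\<in>S. \<bar>A $$ (j, i)\<bar>)}" "card J = l s"
      by (rule obtain_subset_with_card_n[OF le]) (rule that)
    have "finite J" using J(1) finite_subset by fastforce
    have entry: "\<bar>A $$ (j, i)\<bar> = (if A $$ (j, i) = 1 then 1 else 0)" if "j \<in> J" "i \<in> S" for j i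
      using random_sparse_matrix_entries[OF P assms(5) A, of j i] that J(1) S(1) by auto
    have "J \<noteq> {}" using J(2) s by (auto simp: l_def)
    then obtain j where j: "j \<in> J" by blast
    have "r s \<le> (\<Sum>i\<in>S. \<bar>A $$ (j, i)\<bar>)" using j J(1) by auto
    also have "\<dots> \<le> (\<Sum>i\<in>S. 1)" using entry[OF j] by (intro sum_mono) auto
    finally have "s \<in> I" using S(3) s by (simp add: I_def s_def)
    have "real (l s) * r s \<le> (\<Sum>j\<in>J. \<Sum>i\<in>S. \<bar>A $$ (j, i)\<bar>)"
      using sum_bounded_below[of J "r s" "\<lambda>j. \<Sum>i\<in>S. \<bar>A $$ (j, i)\<bar>"] J by auto
    also have "\<dots> = (\<Sum>j\<in>J. \<Sum>i\<in>S. if A $$ (j, i) = 1 then 1 else 0)"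
      using entry by (intro sum.cong) auto
    also have "\<dots> = (\<Sum>e\<in>J \<times> S. if A $$ e = 1 then 1 else 0)"
      by (simp add: sum.cartesian_product case_prod_unfold)
    also have "\<dots> = real (card {e \<in> J \<times> S. A $$ e = 1})"
      using \<open>finite J\<close> \<open>finite S\<close> by (simp add: sum.If_cases Int_def)
    finally have "q s \<le> card {e \<in> J \<times> S. A $$ e = 1}"
      unfolding q_def by linarith
    then have "A \<in> D s" using S(1) J unfolding D_def s_def by blast
    then show "A \<in> (\<Union>s\<in>I. D s)" using \<open>s \<in> I\<close> by blast
  qed simp
  also have "\<dots> \<le> (\<Sum>s\<in>I. measure_pmf.prob P (D s))"
    by (intro measure_pmf.finite_measure_subadditive_finite I) auto
  also have "\<dots> \<le> (\<Sum>s\<in>I. exp (- real t) * exp (- real s))"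
  proof (intro sum_mono)
    fix s assume s: "s \<in> I"
    have "measure_pmf.prob P (D s)
        \<le> real (k choose s) * real (m choose l s) * real (l s * s choose q s) * (real t / real m) ^ q s"
      unfolding D_def by (intro prob_dense_submatrix_le P assms)
    also have "\<dots> \<le> exp (- real t - real s)"
      using s assms by (intro union_bound_estimate[where r = "r s"]) (auto simp: I_def r_def l_def q_def)
    finally show "measure_pmf.prob P (D s) \<le> exp (- real t) * exp (- real s)"
      by (simp flip: exp_add)
  qed
  also have "\<dots> \<le> exp (- real t) * (\<Sum>s = 1..m. exp (- real s))"
    unfolding sum_distrib_left using I by (intro sum_mono2) auto
  also have "\<dots> \<le> exp (- real t) * 1"
    by (intro mult_left_mono sum_exp_neg_le_1) auto
  finally show ?thesis by (simp add: r_def)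
qed

section \<open>From good matrices to the discrepancy bound\<close>

theorem theorem4:
  shows "\<exists>C0 C1 :: real. C0 > 0 \<and> C1 > 0 \<and>
    (\<forall>(m::nat) (k::nat) (t::nat) (x0 :: real vec) (P :: real mat pmf).
      0 < m \<longrightarrow> 0 < k \<longrightarrow> 0 < t \<longrightarrow> t \<le> m \<longrightarrow>
      real t \<ge> C0 * (ln (exp 1 * real k / real m))\<^sup>2 \<longrightarrow>
      x0 \<in> carrier_vec k \<longrightarrow> (\<forall>i<k. x0 $ i \<in> {-1..1}) \<longrightarrow>
      random_sparse_matrix m k t P \<longrightarrow>
      measure_pmf.prob P
        {A. \<exists>\<chi> \<in> carrier_vec k. (\<forall>i<k. \<chi> $ i \<in> {-1, 1}) \<and>
              (\<forall>j<m. \<bar>row A j \<bullet> (\<chi> - x0)\<bar> \<le> C1 * sqrt (real t))}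
        \<ge> 1 - exp (- real t))"
proof (intro exI conjI allI impI)
  \<comment> \<open>The witnesses are fixed here: \<open>C0\<close> is 1, and \<open>C1\<close> adds
    the geometric series of the halvings to the 1018 of the final rounding.\<close>
  show "(1::real) > 0" by simp
  show "halving_const + 1018 > 0" using halving_const(1) by simp
next
  fix m k t :: nat and x0 :: "real vec" and P :: "real mat pmf"
  assume *: "0 < m" "0 < k" "0 < t" "t \<le> m" "1 * (ln (exp 1 * real k / real m))\<^sup>2 \<le> real t"
    and x0: "x0 \<in> carrier_vec k" "\<forall>i<k. x0 $ i \<in> {-1..1}" and P: "random_sparse_matrix m k t P"
  define bad where "bad = {A :: real mat. \<exists>S. S \<subseteq> {..<k} \<and> S \<noteq> {} \<and> card S \<le> m \<and>
    card S \<le> 100 * card {j\<in>{..<m}. 9 * real (card S) * real t / real m + 500 * sqrt t \<le> (\<Sum>i\<in>S. \<bar>A $$ (j, i)\<bar>)}}"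
  have "1 - exp (- real t) \<le> 1 - measure_pmf.prob P bad"
    using prob_heavy_rows_le[OF P] * unfolding bad_def by simp
  also have "\<dots> = measure_pmf.prob P (- bad)"
    by (simp add: measure_pmf.prob_compl[symmetric] Compl_eq_Diff_UNIV)
  also have "\<dots> \<le> measure_pmf.prob P {A. \<exists>\<chi> \<in> carrier_vec k. (\<forall>i<k. \<chi> $ i \<in> {-1, 1}) \<and>
              (\<forall>j<m. \<bar>row A j \<bullet> (\<chi> - x0)\<bar> \<le> (halving_const + 1018) * sqrt (real t))}"
  \<comment> \<open>The inclusion is proved on the support of \<open>P\<close> only, where the
    dimensions are right and the entries are 0 or 1.\<close>
  proof (rule measure_pmf.finite_measure_mono_AE[OF AE_pmfI], rule impI)
    fix A assume A: "A \<in> set_pmf P" and good: "A \<in> - bad"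
    have carrier: "A \<in> carrier_mat m k" using P A by (auto simp: random_sparse_matrix_def)
    have entries: "\<bar>A $$ (j, i)\<bar> \<le> 1" if "j < m" "i \<in> {..<k}" for j i
      using random_sparse_matrix_entries[OF P *(4) A] that by fastforce
    have "\<exists>x. (\<forall>i\<in>{..<k}. \<bar>x i\<bar> = 1) \<and>
      (\<forall>j<m. \<bar>\<Sum>i\<in>{..<k}. A $$ (j, i) * (x i - x0 $ i)\<bar> \<le> (halving_const + 1018) * sqrt t)"
    proof (rule full_coloring)
      show "100 * card {j\<in>{..<m}. 9 * real (card S) * real t / real m + 500 * sqrt t
          \<le> (\<Sum>i\<in>S. \<bar>A $$ (j, i)\<bar>)} < card S"
        if "S \<subseteq> {..<k}" "S \<noteq> {}" "card S \<le> m" for S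
      proof (rule ccontr)
        assume "\<not> ?thesis"
        then have "A \<in> bad"
          unfolding bad_def mem_Collect_eq using that by (intro exI[of _ S]) linarith
        then show False using good by simp
      qed
    qed (use * x0 entries in \<open>auto simp: abs_le_iff\<close>)
    then obtain x where x: "\<And>i. i < k \<Longrightarrow> \<bar>x i\<bar> = 1"
      "\<And>j. j < m \<Longrightarrow> \<bar>\<Sum>i\<in>{..<k}. A $$ (j, i) * (x i - x0 $ i)\<bar> \<le> (halving_const + 1018) * sqrt t"
      by auto
    have row_eq: "row A j \<bullet> (vec k x - x0) = (\<Sum>i\<in>{..<k}. A $$ (j, i) * (x i - x0 $ i))" if "j < m" for j
      using carrier x0(1) that by (auto simp: scalar_prod_def lessThan_atLeast0 intro!: sum.cong)
    have disc: "\<bar>row A j \<bullet> (vec k x - x0)\<bar> \<le> (halving_const + 1018) * sqrt t" if "j < m" for j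
      unfolding row_eq[OF that] by (rule x(2)[OF that])
    have signs: "vec k x $ i \<in> {-1, 1}" if "i < k" for i
      using x(1)[OF that] that by (auto simp: abs_if split: if_splits)
    show "A \<in> {A. \<exists>\<chi> \<in> carrier_vec k. (\<forall>i<k. \<chi> $ i \<in> {-1, 1}) \<and>
              (\<forall>j<m. \<bar>row A j \<bullet> (\<chi> - x0)\<bar> \<le> (halving_const + 1018) * sqrt (real t))}"
      by (intro CollectI bexI[of _ "vec k x"] conjI allI impI disc signs) auto
  qed simp
  finally show "1 - exp (- real t) \<le> measure_pmf.prob P {A. \<exists>\<chi> \<in> carrier_vec k. (\<forall>i<k. \<chi> $ i \<in> {-1, 1}) \<and>
              (\<forall>j<m. \<bar>row A j \<bullet> (\<chi> - x0)\<bar> \<le> (halving_const + 1018) * sqrt (real t))}" .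
qed

end
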